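(* For any points $y_1,y_2,\ldots,y_p\in(0,1/2)$ (with $p\ge 1$ any positive integer) we have $$\dim_H\bigcap_{i=1}^p\Lambda(y_i)=1,$$ where $\Lambda(y)=\{\lambda\in(0,1/2]: y\in K_\lambda\}$.
   Context: For $\lambda\in(0,1/2]$, $K_\lambda\subset\mathbb{R}$ is the self-similar set generated by the iterated function system $\{f_{\lambda,d}(x)=\lambda x+d(1-\lambda): d=0,1\}$, i.e. the unique nonempty compact set with $K_\lambda=f_{\lambda,0}(K_\lambda)\cup f_{\lambda,1}(K_\lambda)$; equivalently $K_\lambda=\{(1-\lambda)\sum_{n=1}^\infty i_n\lambda^{n-1}: i_n\in\{0,1\}\ \forall n\ge 1\}$. $\dim_H$ denotes Hausdorff dimension. *)

theory Defs
  imports "HOL-Analysis.Analysis"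
begin

section \<open>Hausdorff dimension\<close>

text \<open>
  The two conditional clauses keep the counting-measure convention for exponent \<open>0\<close>
  (\<open>0 powr 0 = 0\<close> in the library, whereas a point has \<open>0\<close>-dimensional weight \<open>1\<close>).
\<close>

definition diam_pow :: "real \<Rightarrow> 'a::metric_space set \<Rightarrow> ennreal" where
  "diam_pow s U =
     (if U = {} then 0 else if s = 0 then 1 else ennreal (diameter U powr s))"

text \<open>
  The covering sets are required to be bounded because the library's \<^const>\<open>diameter\<close>
  is not the true diameter on unbounded sets. Finite covers are included by
  padding with empty sets.
\<close>

definition delta_covers :: "real \<Rightarrow> 'a::metric_space set \<Rightarrow> (nat \<Rightarrow> 'a set) set" where
  "delta_covers \<delta> A =
     {U. A \<subseteq> (\<Union>i. U i) \<and> (\<forall>i. bounded (U i) \<and> diameter (U i) \<le> \<delta>)}"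

definition hausdorff_premeasure :: "real \<Rightarrow> real \<Rightarrow> 'a::metric_space set \<Rightarrow> ennreal" where
  "hausdorff_premeasure s \<delta> A = (INF U\<in>delta_covers \<delta> A. \<Sum>i. diam_pow s (U i))"

definition hausdorff_measure :: "real \<Rightarrow> 'a::metric_space set \<Rightarrow> ennreal" where
  "hausdorff_measure s A = (SUP \<delta>\<in>{0<..}. hausdorff_premeasure s \<delta> A)"

definition hausdorff_dim :: "'a::metric_space set \<Rightarrow> ennreal" where
  "hausdorff_dim A = Inf {ennreal s |s. 0 \<le> s \<and> hausdorff_measure s A = 0}"

section \<open>The self-similar sets\<close>

text \<open>The contraction ratio is written \<open>\<rho>\<close>, since \<open>\<lambda>\<close> is not available as a variable name.\<close>

definition ifs_map :: "real \<Rightarrow> nat \<Rightarrow> real \<Rightarrow> real" where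
  "ifs_map \<rho> d x = \<rho> * x + real d * (1 - \<rho>)"

definition is_attractor :: "real \<Rightarrow> real set \<Rightarrow> bool" where
  "is_attractor \<rho> K \<longleftrightarrow>
     K \<noteq> {} \<and> compact K \<and> K = ifs_map \<rho> 0 ` K \<union> ifs_map \<rho> 1 ` K"

definition self_similar_set :: "real \<Rightarrow> real set" where
  "self_similar_set \<rho> = (THE K. is_attractor \<rho> K)"

definition Lambda :: "real \<Rightarrow> real set" where
  "Lambda y = {\<rho>\<in>{0<..1/2}. y \<in> self_similar_set \<rho>}"

text \<open>The description by \<open>THE\<close> is meaningful: the attractor exists and is unique.\<close>

lemma attractor_subset:
  assumes l: "0 < \<rho>" "\<rho> \<le> 1/2" and K: "is_attractor \<rho> K" and L: "is_attractor \<rho> L"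
  shows "K \<subseteq> L"
proof -
  have K': "K \<noteq> {}" "compact K" "K = ifs_map \<rho> 0 ` K \<union> ifs_map \<rho> 1 ` K"
    and L': "L \<noteq> {}" "compact L" "L = ifs_map \<rho> 0 ` L \<union> ifs_map \<rho> 1 ` L"
    using K L unfolding is_attractor_def by blast+
  have "continuous_on K (\<lambda>x. infdist x L)" by (intro continuous_intros)
  then obtain x where x: "x \<in> K" "\<And>z. z \<in> K \<Longrightarrow> infdist z L \<le> infdist x L"
    using continuous_attains_sup[OF K'(2,1)] by blast
  obtain d x' where d: "d = 0 \<or> d = 1" and x': "x' \<in> K" "x = ifs_map \<rho> d x'"
    using x(1) K'(3) by blast
  have "closed L" using L'(2) compact_imp_closed by blast
  then obtain z where z: "z \<in> L" "infdist x' L = dist x' z"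
    using infdist_attains_inf L'(1) by metis
  have "ifs_map \<rho> d z \<in> L" using z(1) d L'(3) by blast
  then have "infdist x L \<le> dist (ifs_map \<rho> d x') (ifs_map \<rho> d z)"
    using infdist_le x'(2) by blast
  also have "\<dots> = \<rho> * dist x' z"
    using l by (simp add: ifs_map_def dist_real_def abs_mult flip: right_diff_distrib)
  also have "\<dots> \<le> \<rho> * infdist x L" using x(2)[OF x'(1)] z(2) l by simp
  also have "\<dots> \<le> 1/2 * infdist x L" using l infdist_nonneg by (intro mult_right_mono) auto
  finally have "infdist x L \<le> 0" by simp
  then have "infdist w L = 0" if "w \<in> K" for w
    using x(2)[OF that] infdist_nonneg[of w L] by linarith
  then show ?thesis using in_closed_iff_infdist_zero[OF \<open>closed L\<close> L'(1)] by blast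
qed

lemma attractor_exists:
  assumes l: "0 < \<rho>" "\<rho> \<le> 1/2"
  shows "\<exists>K. is_attractor \<rho> K"
proof -
  define F where "F A = ifs_map \<rho> 0 ` A \<union> ifs_map \<rho> 1 ` A" for A
  define C where "C n = (F ^^ n) {0..1}" for n :: nat
  have CS: "C (Suc n) = F (C n)" for n by (simp add: C_def)
  have mono: "A \<subseteq> B \<Longrightarrow> F A \<subseteq> F B" for A B by (auto simp: F_def)
  have bnd: "0 \<le> \<rho> * x \<and> \<rho> * x \<le> \<rho>" if "0 \<le> x" "x \<le> 1" for x
    using that l mult_left_mono[of x 1 \<rho>] by simp
  have sub: "C (Suc n) \<subseteq> C n" for n
  proof (induction n)
    case 0
    then show ?case using l bnd by (fastforce simp: C_def F_def ifs_map_def)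
  next
    case (Suc n)
    then show ?case using mono CS by metis
  qed
  have dec: "C n \<subseteq> C m" if "m \<le> n" for m n
    using lift_Suc_antimono_le[of C] sub that by blast
  have comp: "compact (C n)" for n
  proof (induction n)
    case (Suc n)
    then show ?case unfolding CS F_def
      by (intro compact_Un compact_continuous_image) (auto simp: ifs_map_def intro!: continuous_intros)
  qed (simp add: C_def)
  have zero: "0 \<in> C n" for n
  proof (induction n)
    case (Suc n)
    then show ?case unfolding CS F_def by (auto simp: ifs_map_def image_iff)
  qed (simp add: C_def)
  define K where "K = (\<Inter>n. C n)"
  have "compact K" unfolding K_def using comp compact_imp_closed
    by (intro compact_Inter) auto
  moreover have "K \<noteq> {}" using zero by (auto simp: K_def)
  moreover have "F K \<subseteq> K"
  proof -
    have "F K \<subseteq> C (Suc n)" for n unfolding CS by (rule mono) (auto simp: K_def)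
    then show ?thesis using sub by (force simp: K_def)
  qed
  moreover have "K \<subseteq> F K"
  proof
    fix x assume x: "x \<in> K"
    have inv: "ifs_map \<rho> d z = x \<longleftrightarrow> z = (x - real d * (1 - \<rho>)) / \<rho>" for d z
      using l by (auto simp: ifs_map_def field_simps)
    define g where "g d = (x - real d * (1 - \<rho>)) / \<rho>" for d :: nat
    have g: "ifs_map \<rho> d (g d) = x" for d using inv g_def by blast
    have ex: "g 0 \<in> C n \<or> g 1 \<in> C n" for n
    proof -
      have "x \<in> F (C n)" using x CS[of n] by (auto simp: K_def)
      then obtain d z where "d = 0 \<or> d = 1" "z \<in> C n" "ifs_map \<rho> d z = x"
        unfolding F_def by blast
      then show ?thesis using inv g_def by auto
    qed
    have "g 0 \<in> K \<or> g 1 \<in> K"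
    proof (rule ccontr)
      assume "\<not> ?thesis"
      then obtain m n where "g 0 \<notin> C m" "g 1 \<notin> C n" by (auto simp: K_def)
      then show False using ex[of "max m n"] dec[of m "max m n"] dec[of n "max m n"] by auto
    qed
    then show "x \<in> F K" unfolding F_def using g by (metis UnI1 UnI2 image_eqI)
  qed
  ultimately show ?thesis unfolding is_attractor_def F_def by blast
qed

lemma is_attractor_self_similar_set:
  assumes "0 < \<rho>" "\<rho> \<le> 1/2"
  shows "is_attractor \<rho> (self_similar_set \<rho>)"
  unfolding self_similar_set_def
  using attractor_exists[OF assms] attractor_subset[OF assms] by (metis theI subset_antisym)

end

theory Submission
  imports Defs "HOL-Real_Asymp.Real_Asymp"
begin

text \<open>
  A bounded subset of the line has dimension at most \<open>1\<close>, so it remains to see that for every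
  \<open>0 \<le> s < 1\<close> the common parameter set \<open>E\<close> has positive \<open>s\<close>-dimensional
  Hausdorff measure; the part of \<open>E\<close> just below \<open>1/2\<close> is already enough. The reason is that
  \<open>K\<^sub>t\<close> has relative gaps of size \<open>1 - 2 * t\<close>, which tend to \<open>0\<close> as \<open>t\<close> tends to \<open>1/2\<close>, and that
  this thickness is inherited by the parameter sets: near \<open>1/2\<close> each of them is an interval from
  which holes have been removed that are tiny compared with the intervals that separate them. Sets
  of this kind, finitely many at a time, intersect in a set of large dimension.

  Parameter space. For a binary word \<open>w\<close> of length \<open>n\<close> let \<open>x\<^sub>w(t)\<close> be the point that the
  similarity of \<open>K\<^sub>t\<close> coded by \<open>w\<close> maps to \<open>y\<close> (\<open>tail_point\<close>). The parameters whose level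
  \<open>n\<close> approximation of \<open>K\<^sub>t\<close> contains \<open>y\<close> in its piece \<open>w\<close> are those with \<open>0 \<le> x\<^sub>w(t) \<le> 1\<close>; they form a
  cylinder. The hole of \<open>w\<close> consists of those with \<open>t < x\<^sub>w(t) < 1 - t\<close>, for which no next digit
  exists. Since \<open>y < 1/2\<close>, words start with the digit \<open>0\<close>; this makes \<open>x\<^sub>w\<close> decreasing in \<open>t\<close>, so
  that cylinders are intervals. If in addition \<open>x\<^sub>w\<close> falls fast enough, its speed varies by at most
  a constant factor over a cylinder (\<open>bounded_distortion\<close>). Then lengths in the parameter line
  compare like lengths in \<open>[0, 1]\<close>: a hole is at most a constant times \<open>1 - 2 * t\<close> times as long
  as each of the two cylinders next to it.

  One step of the construction. Let \<open>J\<close> be an interval of parameters and \<open>w\<close> a longest word whose cylinder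
  contains \<open>J\<close>, and suppose that the hole of \<open>w\<close> occupies at most an \<open>N\<close>-th part of \<open>J\<close>. Cut \<open>J\<close> into \<open>N\<close>
  equal pieces. At most three meet the hole. Any other piece \<open>J'\<close> has a longer maximal word \<open>u\<close>,
  and \<open>J\<close>, which leaves the cylinder of \<open>u\<close>, must run across one of the two cylinders next to
  the hole of \<open>u\<close>. By bounded distortion that hole is shorter than \<open>|J| / N\<^sup>2\<close>, provided \<open>1 - 2 * t\<close> is
  small compared with \<open>1 / N\<^sup>2\<close>, so \<open>J'\<close> is as good as \<open>J\<close> (\<open>stage_Suc\<close>). With \<open>p\<close> points at once, at
  most \<open>3 * p\<close> of the \<open>N\<close> pieces are lost at every step.

  Dimension. A nested construction that keeps at least \<open>N - K \<ge> 3 * N powr s\<close> of \<open>N\<close> pieces at every step cannot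
  be covered cheaply (\<open>hausdorff_measure_nonzero_of_branching\<close>): given a cover with small total
  weight, one chooses piece after piece so that the weight of the cover sets met by the piece
  decreases like \<open>N powr (- s)\<close> per step, and the intersection of these pieces is a point of the set that is not
  covered. As \<open>s < 1\<close>, the condition holds for \<open>K = 3 * p\<close> and \<open>N\<close> large.

  Getting started. The induction needs a first window \<open>[1/2 - e, 1/2 - e/2]\<close> inside one cylinder on which
  \<open>x\<^sub>w\<close> is already steep, for all given points at once (\<open>eventually_seeded_window\<close>). Binary
  digits of \<open>y\<close> provide the word, except for \<open>y = 1/4\<close>, where the derivative of the coding
  series degenerates at \<open>t = 1/2\<close> and the length of the word has to be adapted to \<open>e\<close>.
\<close>

section \<open>Words, cylinders and holes\<close>

text \<open>
  The left endpoint of the piece of level \<open>length w\<close> of \<open>K\<^sub>t\<close> that is coded by \<open>w\<close>; the piece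
  has length \<open>t ^ length w\<close>.
\<close>

definition word_sum :: "bool list \<Rightarrow> real \<Rightarrow> real" where
  "word_sum w t = (\<Sum>k<length w. of_bool (w ! k) * ((1 - t) * t ^ k))"

definition word_sum_deriv :: "bool list \<Rightarrow> real \<Rightarrow> real" where
  "word_sum_deriv w t =
     (\<Sum>k<length w. of_bool (w ! k) * (real k * t ^ (k - 1) - real (Suc k) * t ^ k))"

text \<open>
  The similarity coded by \<open>w\<close> is \<open>x \<mapsto> word_sum w t + t ^ length w * x\<close>; this is its inverse
  at \<open>y\<close>.
\<close>

definition tail_point :: "real \<Rightarrow> bool list \<Rightarrow> real \<Rightarrow> real" where
  "tail_point y w t = (y - word_sum w t) / t ^ length w"

definition cylinder :: "real \<Rightarrow> bool list \<Rightarrow> real set" where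
  "cylinder y w = {t. 0 \<le> tail_point y w t \<and> tail_point y w t \<le> 1}"

text \<open>
  After the digits \<open>w\<close>, digit \<open>0\<close> is possible if the tail point lies in \<open>[0, t]\<close> and digit \<open>1\<close>
  if it lies in \<open>[1 - t, 1]\<close>. In a hole it lies strictly between.
\<close>

definition hole :: "real \<Rightarrow> bool list \<Rightarrow> real set" where
  "hole y w = {t. t < tail_point y w t \<and> tail_point y w t < 1 - t}"

text \<open>
  Minus the derivative of the tail point with respect to \<open>t\<close>.
\<close>

definition speed :: "real \<Rightarrow> bool list \<Rightarrow> real \<Rightarrow> real" where
  "speed y w t = real (length w) * tail_point y w t / t + word_sum_deriv w t / t ^ length w"

lemma word_sum_Nil [simp]: "word_sum [] t = 0"
  by (simp add: word_sum_def)

lemma word_sum_snoc: "word_sum (w @ [d]) t = word_sum w t + of_bool d * ((1 - t) * t ^ length w)"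
proof -
  have "(\<Sum>k<length w. of_bool ((w @ [d]) ! k) * ((1 - t) * t ^ k)) = word_sum w t"
    unfolding word_sum_def by (intro sum.cong) (auto simp: nth_append)
  then show ?thesis by (simp add: word_sum_def)
qed

lemma word_sum_Cons: "word_sum (d # w) t = of_bool d * (1 - t) + t * word_sum w t"
proof -
  have "t * word_sum w t = (\<Sum>k<length w. of_bool (w ! k) * ((1 - t) * t ^ Suc k))"
    unfolding word_sum_def sum_distrib_left by (intro sum.cong) auto
  then show ?thesis unfolding word_sum_def by (simp add: sum.lessThan_Suc_shift del: sum.lessThan_Suc)
qed

lemma tail_point_snoc:
  assumes "0 < t"
  shows "tail_point y (w @ [d]) t = (tail_point y w t - of_bool d * (1 - t)) / t"
proof -
  define P where "P = t ^ length w"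
  have "P \<noteq> 0" using assms by (simp add: P_def)
  then show ?thesis
    using assms by (simp add: tail_point_def word_sum_snoc flip: P_def) (simp add: divide_simps)
qed

text \<open>
  A point outside the unit interval is moved further out by appending a digit, since the inverse
  branches expand away from \<open>[0, 1]\<close>. So a cylinder is determined by the last tail point alone. The
  two one-sided forms are needed separately to see at which end an interval leaves a cylinder.
\<close>

lemma tail_point_snoc_bounds:
  assumes "0 < t" "t \<le> 1"
  shows "0 \<le> tail_point y (w @ [d]) t \<Longrightarrow> 0 \<le> tail_point y w t"
    and "tail_point y (w @ [d]) t \<le> 1 \<Longrightarrow> tail_point y w t \<le> 1"
proof -
  have e: "tail_point y w t = t * tail_point y (w @ [d]) t + of_bool d * (1 - t)"
    using assms by (simp add: tail_point_snoc)
  show "0 \<le> tail_point y (w @ [d]) t \<Longrightarrow> 0 \<le> tail_point y w t"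
    unfolding e using assms by (intro add_nonneg_nonneg mult_nonneg_nonneg) auto
  assume "tail_point y (w @ [d]) t \<le> 1"
  then have "t * tail_point y (w @ [d]) t \<le> t" using assms by simp
  moreover have "of_bool d * (1 - t) \<le> 1 - t" using assms by simp
  ultimately show "tail_point y w t \<le> 1" unfolding e by linarith
qed

lemma tail_point_append_bounds:
  assumes "0 < t" "t \<le> 1"
  shows "0 \<le> tail_point y (w @ v) t \<Longrightarrow> 0 \<le> tail_point y w t"
    and "tail_point y (w @ v) t \<le> 1 \<Longrightarrow> tail_point y w t \<le> 1"
proof -
  have "(0 \<le> tail_point y (w @ v) t \<longrightarrow> 0 \<le> tail_point y w t) \<and>
        (tail_point y (w @ v) t \<le> 1 \<longrightarrow> tail_point y w t \<le> 1)"
  proof (induction v rule: rev_induct)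
    case (snoc d v)
    then show ?case using tail_point_snoc_bounds[OF assms, of y "w @ v" d] by simp
  qed simp
  then show "0 \<le> tail_point y (w @ v) t \<Longrightarrow> 0 \<le> tail_point y w t"
    and "tail_point y (w @ v) t \<le> 1 \<Longrightarrow> tail_point y w t \<le> 1" by blast+
qed

text \<open>
  If the parameter lies in cylinders of arbitrarily long words, then \<open>y\<close> lies in pieces of
  arbitrarily small diameter, each of which contains a point of \<open>K\<^sub>t\<close>; and \<open>K\<^sub>t\<close> is closed.
\<close>

lemma mem_LambdaI:
  assumes t: "0 < t" "t \<le> 1/2"
    and long: "\<And>n. \<exists>w. n \<le> length w \<and> t \<in> cylinder y w"
  shows "t \<in> Lambda y"
proof -
  define K where "K = self_similar_set t"
  have K: "K \<noteq> {}" "compact K" "K = ifs_map t 0 ` K \<union> ifs_map t 1 ` K"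
    using is_attractor_self_similar_set[OF t] unfolding K_def is_attractor_def by blast+
  obtain x where x: "x \<in> K" using K(1) by blast
  have branch: "word_sum w t + t ^ length w * x \<in> K" for w
  proof (induction w)
    case (Cons d w)
    have "ifs_map t (of_bool d) (word_sum w t + t ^ length w * x) \<in> K"
      using Cons K(3) by (cases d) auto
    then show ?case by (simp add: ifs_map_def word_sum_Cons algebra_simps)
  qed (use x in simp)
  have "\<exists>z\<in>K. dist z y < r" if "0 < r" for r
  proof -
    have "(\<lambda>n. t ^ n * (1 + \<bar>x\<bar>)) \<longlonglongrightarrow> 0 * (1 + \<bar>x\<bar>)"
      using t by (intro tendsto_mult LIMSEQ_power_zero tendsto_const) auto
    then have "(\<lambda>n. t ^ n * (1 + \<bar>x\<bar>)) \<longlonglongrightarrow> 0" by simp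
    then obtain n where n: "t ^ n * (1 + \<bar>x\<bar>) < r"
      using eventually_happens'[OF sequentially_bot order_tendstoD(2)[OF _ \<open>0 < r\<close>]] by blast
    obtain w where w: "n \<le> length w" "t \<in> cylinder y w" using long by blast
    define e where "e = tail_point y w t"
    have e: "0 \<le> e" "e \<le> 1" using w(2) by (auto simp: cylinder_def e_def)
    have y: "y = word_sum w t + t ^ length w * e" using t by (simp add: e_def tail_point_def)
    have "dist (word_sum w t + t ^ length w * x) y = t ^ length w * \<bar>x - e\<bar>"
      using t by (simp add: y dist_real_def abs_mult flip: right_diff_distrib)
    also have "\<dots> \<le> t ^ n * (1 + \<bar>x\<bar>)"
      using t w(1) e by (intro mult_mono power_decreasing) auto
    finally show ?thesis using branch n by (meson le_less_trans)
  qed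
  then have "y \<in> K" using compact_imp_closed[OF K(2)] by (meson closed_approachable)
  then show ?thesis using t by (simp add: Lambda_def K_def)
qed

section \<open>Monotone dependence on the parameter\<close>

lemma has_real_derivative_word_sum:
  "(word_sum w has_real_derivative word_sum_deriv w t) (at t)"
proof -
  have "((\<lambda>t. (1 - t) * t ^ k) has_real_derivative
          (real k * t ^ (k - 1) - real (Suc k) * t ^ k)) (at t)" for k
  proof (cases k)
    case (Suc m)
    have "((\<lambda>t. t ^ k - t ^ Suc k) has_real_derivative
            (real k * t ^ (k - 1) - real (Suc k) * t ^ k)) (at t)"
      using DERIV_diff[OF DERIV_pow[of k t] DERIV_pow[of "Suc k" t]] by simp
    then show ?thesis by (simp add: algebra_simps)
  qed (auto intro!: derivative_eq_intros)
  then show ?thesis unfolding word_sum_def word_sum_deriv_def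
    by (intro DERIV_sum DERIV_cmult)
qed

lemma has_real_derivative_tail_point:
  assumes "0 < t"
  shows "(tail_point y w has_real_derivative - speed y w t) (at t)"
proof -
  have n: "real n * t ^ (n - Suc 0) = real n * t ^ n / t" for n
    using assms by (cases n) auto
  show ?thesis unfolding tail_point_def[abs_def] speed_def
    using assms
    by (auto intro!: derivative_eq_intros has_real_derivative_word_sum simp: n field_simps)
qed

lemma tail_point_fall:
  assumes "0 < a" "a < b"
  obtains x where "a < x" "x < b" "tail_point y w a - tail_point y w b = (b - a) * speed y w x"
proof -
  have "\<exists>z>a. z < b \<and> tail_point y w b - tail_point y w a = (b - a) * - speed y w z"
    using assms by (intro MVT2 has_real_derivative_tail_point) auto
  then show ?thesis using that by (auto simp: algebra_simps)
qed

lemma continuous_on_tail_point: "0 < a \<Longrightarrow> continuous_on {a..b} (tail_point y w)"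
  by (rule DERIV_continuous_on[where D = "\<lambda>t. - speed y w t"],
      rule has_field_derivative_at_within, rule has_real_derivative_tail_point, simp)

lemma deriv_term_factor:
  "1 \<le> k \<Longrightarrow> real k * t ^ (k - 1) - real (Suc k) * t ^ k = t ^ (k - 1) * (real k - real (Suc k) * t)"
  by (cases k) (auto simp: algebra_simps)

text \<open>
  Each summand \<open>(1 - t) * t ^ k\<close> with \<open>k \<ge> 1\<close> increases on \<open>(0, 1/2]\<close>, whereas \<open>k = 0\<close> gives the
  decreasing \<open>1 - t\<close>. This is why words are required to start with the digit \<open>0\<close>.
\<close>

lemma deriv_term_nonneg:
  fixes t :: real
  assumes "1 \<le> k" "0 < t" "t \<le> 1/2"
  shows "0 \<le> real k * t ^ (k - 1) - real (Suc k) * t ^ k"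
proof -
  have "real (Suc k) * t \<le> real (Suc k) * (1/2)" using assms by (intro mult_left_mono) auto
  also have "\<dots> \<le> real k" using assms by simp
  finally show ?thesis using assms unfolding deriv_term_factor[OF assms(1)] by simp
qed

lemma deriv_summand_nonneg:
  fixes t :: real
  assumes "w \<noteq> []" "\<not> hd w" "0 < t" "t \<le> 1/2"
  shows "0 \<le> of_bool (w ! k) * (real k * t ^ (k - 1) - real (Suc k) * t ^ k)"
proof (cases "k = 0")
  case True
  then show ?thesis using assms by (simp add: hd_conv_nth)
next
  case False
  then show ?thesis using deriv_term_nonneg[of k t] assms by simp
qed

lemma word_sum_deriv_nonneg:
  assumes "w \<noteq> []" "\<not> hd w" "0 < t" "t \<le> 1/2"
  shows "0 \<le> word_sum_deriv w t"
  unfolding word_sum_deriv_def using deriv_summand_nonneg[OF assms] by (intro sum_nonneg) auto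

lemma word_sum_deriv_append_ge:
  assumes "w \<noteq> []" "\<not> hd w" "0 < t" "t \<le> 1/2"
  shows "word_sum_deriv w t \<le> word_sum_deriv (w @ v) t"
proof -
  let ?f = "\<lambda>k. of_bool ((w @ v) ! k) * (real k * t ^ (k - 1) - real (Suc k) * t ^ k)"
  have "word_sum_deriv w t = (\<Sum>k<length w. ?f k)"
    unfolding word_sum_deriv_def by (intro sum.cong) (auto simp: nth_append)
  also have "\<dots> \<le> (\<Sum>k<length (w @ v). ?f k)"
    using deriv_summand_nonneg[of "w @ v" t] assms by (intro sum_mono2) auto
  finally show ?thesis by (simp add: word_sum_deriv_def)
qed

lemma word_sum_mono:
  assumes "w \<noteq> []" "\<not> hd w" "0 < s" "s \<le> t" "t \<le> 1/2"
  shows "word_sum w s \<le> word_sum w t"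
proof (rule DERIV_nonneg_imp_nondecreasing[OF assms(4)])
  fix x assume "s \<le> x" "x \<le> t"
  then show "\<exists>D. (word_sum w has_real_derivative D) (at x) \<and> 0 \<le> D"
    using has_real_derivative_word_sum[of w x] word_sum_deriv_nonneg[of w x] assms by auto
qed

text \<open>
  Nonnegativity says that \<open>y\<close> is to the right of the left endpoint of its piece, and \<open>\<le> 1\<close> that it is
  to the left of the right endpoint. Both endpoints move to the right as \<open>t\<close> grows, so each
  condition is inherited in one direction.
\<close>

lemma tail_point_nonneg_left:
  assumes "w \<noteq> []" "\<not> hd w" "0 < s" "s \<le> t" "t \<le> 1/2" "0 \<le> tail_point y w t"
  shows "0 \<le> tail_point y w s"
proof -
  have "0 < t ^ length w" "0 < s ^ length w" using assms by auto
  then show ?thesis using word_sum_mono[OF assms(1-5)] assms(6)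
    by (auto simp: tail_point_def zero_le_divide_iff)
qed

lemma tail_point_le_one_right:
  assumes "w \<noteq> []" "\<not> hd w" "0 < s" "s \<le> t" "t \<le> 1/2" "tail_point y w s \<le> 1"
  shows "tail_point y w t \<le> 1"
proof -
  have "y - word_sum w t \<le> y - word_sum w s" using word_sum_mono[OF assms(1-5)] by simp
  also have "\<dots> \<le> s ^ length w" using assms by (simp add: tail_point_def divide_le_eq)
  also have "\<dots> \<le> t ^ length w" using assms by (intro power_mono) auto
  finally show ?thesis using assms by (simp add: tail_point_def divide_le_eq)
qed

lemma cylinder_between:
  assumes "w \<noteq> []" "\<not> hd w" "0 < a" "b \<le> 1/2" "a \<in> cylinder y w" "b \<in> cylinder y w" "a \<le> x" "x \<le> b"
  shows "x \<in> cylinder y w"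
  using tail_point_nonneg_left[of w x b y] tail_point_le_one_right[of w a x y] assms
  by (auto simp: cylinder_def)

section \<open>Bounded distortion near one half\<close>

text \<open>
  The window on which the construction for one point \<open>y\<close> takes place. It keeps away from \<open>1/2\<close>
  because the coefficient of the digit with index \<open>1\<close> in \<open>word_sum_deriv\<close> is \<open>1 - 2 * t\<close>: on the
  window this varies by a factor of at most \<open>2\<close>, whereas it vanishes at \<open>1/2\<close>. The
  constant \<open>100\<close> leaves room for the factor \<open>75\<close> with which the hole bound comes out
  in \<open>stage_Suc\<close>.
\<close>

locale seeded_window =
  fixes y e :: real and w0 :: "bool list" and N :: nat
  assumes N: "1 \<le> N" and e: "0 < e" "e \<le> 1 / (100 * real N ^ 2)"
    and w0: "w0 \<noteq> []" "\<not> hd w0"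
    and seed: "\<And>t. t \<in> {1/2 - e..1/2 - e/2} \<Longrightarrow> t \<in> cylinder y w0"
    and steep: "\<And>t. t \<in> {1/2 - e..1/2 - e/2} \<Longrightarrow>
      4 * real N * real (length w0) \<le> word_sum_deriv w0 t / t ^ length w0"
begin

definition window :: "real set" where
  "window = {1/2 - e..1/2 - e/2}"

lemma e_small: "e \<le> 1/100"
proof -
  have "1 \<le> real N ^ 2" using N by simp
  then have "1 / (100 * real N ^ 2) \<le> 1 / 100" using N by (intro divide_left_mono) auto
  then show ?thesis using e by linarith
qed

lemma windowD: "t \<in> window \<Longrightarrow> 2/5 \<le> t \<and> t < 1/2 \<and> 1 - 2 * t \<le> 2 * e \<and> e \<le> 1 - 2 * t"
  using e e_small by (auto simp: window_def)

lemma window_between: "a \<in> window \<Longrightarrow> b \<in> window \<Longrightarrow> a \<le> x \<Longrightarrow> x \<le> b \<Longrightarrow> x \<in> window"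
  by (auto simp: window_def)

abbreviation "ext v \<equiv> w0 @ v"

lemma ext_head: "ext v \<noteq> []" "\<not> hd (ext v)"
  using w0 by auto

lemma length_ext: "1 \<le> length (ext v)" "length v \<le> length (ext v)"
  using w0 by (auto simp: Suc_le_eq)

text \<open>
  Appending \<open>m\<close> digits multiplies the quotient by at least \<open>2 ^ m\<close>, but the length of a nonempty word by at
  most \<open>1 + m\<close>. So steepness has to be arranged for the initial word only.
\<close>

lemma steep_ext:
  assumes t: "t \<in> window"
  shows "4 * real N * real (length (ext v)) \<le> word_sum_deriv (ext v) t / t ^ length (ext v)"
proof -
  let ?m = "length v" and ?n = "length w0"
  have t': "0 < t" "t \<le> 1/2" using windowD[OF t] by auto
  have n: "1 \<le> real ?n" using w0 by (simp add: Suc_le_eq)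
  \<comment> \<open>The growth \<open>2 ^ m\<close> of \<open>1 / t ^ m\<close> absorbs the growth of the length.\<close>
  have "1 + real ?m \<le> (1 + 1) ^ ?m" using Bernoulli_inequality[of 1 ?m] by simp
  also have "\<dots> \<le> (1 / t) ^ ?m" using t' by (intro power_mono) (auto simp: field_simps)
  finally have m: "1 + real ?m \<le> 1 / t ^ ?m" by (simp add: power_one_over)
  have "real ?m \<le> real ?n * real ?m" using mult_right_mono[OF n, of "real ?m"] by simp
  then have "real (length (ext v)) \<le> real ?n * (1 + real ?m)" by (simp add: algebra_simps)
  then have "4 * real N * real (length (ext v)) \<le> 4 * real N * real ?n * (1 + real ?m)"
    using mult_left_mono[of _ _ "4 * real N"] by (simp add: mult.assoc)
  also have "\<dots> \<le> word_sum_deriv w0 t / t ^ ?n * (1 / t ^ ?m)"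
  proof (rule mult_mono[OF _ m])
    show "4 * real N * real ?n \<le> word_sum_deriv w0 t / t ^ ?n" using steep t by (simp add: window_def)
    then show "0 \<le> word_sum_deriv w0 t / t ^ ?n" by (rule order_trans[rotated]) simp
  qed simp
  also have "\<dots> = word_sum_deriv w0 t / t ^ length (ext v)" by (simp add: power_add)
  also have "\<dots> \<le> word_sum_deriv (ext v) t / t ^ length (ext v)"
    using word_sum_deriv_append_ge[OF w0 t'] t' by (intro divide_right_mono) auto
  finally show ?thesis .
qed

text \<open>
  The part of the speed that comes from the factor \<open>1 / t ^ n\<close> is at most \<open>5/2 * n\<close>, and is
  dominated by the other part because of steepness.
\<close>

lemma speed_bounds:
  assumes t: "t \<in> window" and cylinder: "t \<in> cylinder y (ext v)"
  defines "h \<equiv> word_sum_deriv (ext v) t / t ^ length (ext v)"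
  shows "h \<le> speed y (ext v) t" "speed y (ext v) t \<le> 2 * h"
proof -
  let ?n = "real (length (ext v))" and ?x = "tail_point y (ext v) t"
  have x: "0 \<le> ?x" "?x \<le> 1" using cylinder by (auto simp: cylinder_def)
  have t': "2/5 \<le> t" using windowD[OF t] by auto
  have sp: "speed y (ext v) t = ?n * ?x / t + h" by (simp add: speed_def h_def)
  show "h \<le> speed y (ext v) t" unfolding sp using x t' by simp
  have "?n * ?x / t \<le> ?n * 1 / (2/5)" using x t' by (intro frac_le mult_left_mono) auto
  also have "\<dots> = 5/2 * ?n" by simp
  also have "\<dots> \<le> 4 * real N * ?n" using N by (intro mult_right_mono) auto
  also have "\<dots> \<le> h" unfolding h_def by (rule steep_ext[OF t])
  finally show "speed y (ext v) t \<le> 2 * h" unfolding sp by simp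
qed

lemma speed_ge:
  assumes "t \<in> window" "t \<in> cylinder y (ext v)"
  shows "4 * real N * real (length (ext v)) \<le> speed y (ext v) t"
  using steep_ext[OF assms(1), of v] speed_bounds(1)[OF assms] by linarith

lemma cylinder_convex:
  assumes "a \<in> window" "b \<in> window" "a \<in> cylinder y (ext v)" "b \<in> cylinder y (ext v)" "a \<le> x" "x \<le> b"
  shows "x \<in> window" "x \<in> cylinder y (ext v)"
  using cylinder_between[OF ext_head, of a b y v x] window_between[of a b x] windowD[of a] windowD[of b] assms
  by auto

lemma window_fall:
  assumes "a \<in> window" "b \<in> window" "a \<in> cylinder y (ext v)" "b \<in> cylinder y (ext v)" "a < b"
  obtains x where "a < x" "x < b" "x \<in> window" "x \<in> cylinder y (ext v)"
    "tail_point y (ext v) a - tail_point y (ext v) b = (b - a) * speed y (ext v) x"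
proof -
  have "0 < a" using windowD[OF assms(1)] by simp
  then obtain x where x: "a < x" "x < b"
      "tail_point y (ext v) a - tail_point y (ext v) b = (b - a) * speed y (ext v) x"
    using tail_point_fall assms(5) by blast
  then show ?thesis using that cylinder_convex[OF assms(1-4), of x] by auto
qed

lemma fall_ge:
  assumes "a \<in> window" "b \<in> window" "a \<in> cylinder y (ext v)" "b \<in> cylinder y (ext v)" "a \<le> b"
  shows "4 * real N * real (length (ext v)) * (b - a) \<le> tail_point y (ext v) a - tail_point y (ext v) b"
proof (cases "a = b")
  case False
  then obtain x where x: "x \<in> window" "x \<in> cylinder y (ext v)"
      "tail_point y (ext v) a - tail_point y (ext v) b = (b - a) * speed y (ext v) x"
    using window_fall[OF assms(1-4)] assms(5) by (metis order_le_less)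
  show ?thesis unfolding x(3) mult.commute[of _ "b - a"]
    using speed_ge[OF x(1,2)] assms(5) by (intro mult_left_mono) auto
qed simp

lemma fall_ge_width:
  assumes "a \<in> window" "b \<in> window" "a \<in> cylinder y (ext v)" "b \<in> cylinder y (ext v)" "a \<le> b"
  shows "b - a \<le> tail_point y (ext v) a - tail_point y (ext v) b"
proof -
  have "1 * 1 \<le> real N * real (length (ext v))" using N length_ext(1)[of v] by (intro mult_mono) auto
  then have "1 * (b - a) \<le> 4 * real N * real (length (ext v)) * (b - a)"
    using assms(5) by (intro mult_right_mono) linarith+
  from order_trans[OF this fall_ge[OF assms]] show ?thesis by simp
qed

text \<open>
  The tail point has to stay in \<open>[0, 1]\<close> over the whole cylinder while it falls at speed at least
  \<open>4 * N * n\<close>.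
\<close>

lemma cylinder_short:
  assumes "s \<in> window" "t \<in> window" "s \<in> cylinder y (ext v)" "t \<in> cylinder y (ext v)"
  shows "4 * real (length (ext v)) * \<bar>s - t\<bar> \<le> 1"
proof -
  have *: "4 * real (length (ext v)) * (b - a) \<le> 1"
    if "a \<in> window" "b \<in> window" "a \<in> cylinder y (ext v)" "b \<in> cylinder y (ext v)" "a \<le> b" for a b
  proof -
    have "4 * 1 * real (length (ext v)) * (b - a) \<le> 4 * real N * real (length (ext v)) * (b - a)"
      using that N by (intro mult_right_mono mult_left_mono) auto
    also note fall_ge[OF that]
    also have "tail_point y (ext v) a - tail_point y (ext v) b \<le> 1"
      using that by (auto simp: cylinder_def)
    finally show ?thesis by (simp only: mult_1_right)
  qed
  show ?thesis using *[of s t] *[of t s] assms by (cases "s \<le> t") auto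
qed

text \<open>
  The quotient is a sum over the digits \<open>1\<close>, and the comparison holds summand by summand. A
  summand is an affine factor, which varies by a factor of at most \<open>5/2\<close> over the window, divided by a
  power of \<open>t\<close> of exponent at most \<open>n\<close>. Inside the window a cylinder is at
  most \<open>1 / (4 * n)\<close> long, so that power varies by at most a factor of
  \<open>(1 + 1 / n) ^ n \<le> 3\<close>.
\<close>

lemma deriv_ratio:
  assumes s: "s \<in> window" and t: "t \<in> window" and cylinder: "s \<in> cylinder y (ext v)" "t \<in> cylinder y (ext v)"
  shows "word_sum_deriv (ext v) s / s ^ length (ext v)
    \<le> 15/2 * (word_sum_deriv (ext v) t / t ^ length (ext v))"
proof -
  let ?n = "length (ext v)"
  let ?d = "\<lambda>k t. real k * t ^ (k - 1) - real (Suc k) * t ^ k"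
  have s': "2/5 \<le> s" "s < 1/2" "1 - 2 * s \<le> 2 * e" and t': "2/5 \<le> t" "t < 1/2" "e \<le> 1 - 2 * t"
    using windowD[OF s] windowD[OF t] by auto
  have n: "1 \<le> ?n" by (rule length_ext)
  have ratio: "(t / s) ^ m \<le> 3" if "m \<le> ?n" for m
  proof -
    have "1 + (t / s - 1) \<le> 1 + 1 / real ?n"
    proof -
      have "(t - s) * (4 * real ?n) \<le> 1"
        using cylinder_short[OF t s cylinder(2,1)] mult_right_mono[OF abs_ge_self[of "t - s"], of "4 * real ?n"]
        by (simp add: mult.commute)
      then have "(t - s) * real ?n \<le> s" using s' by linarith
      then show ?thesis using s' n by (simp add: field_simps)
    qed
    also have "\<dots> \<le> exp (1 / real ?n)" by (rule exp_ge_add_one_self)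
    finally have "(t / s) ^ m \<le> exp (1 / real ?n) ^ m" using s' t' by (intro power_mono) auto
    also have "\<dots> \<le> exp (1 / real ?n) ^ ?n" using that by (intro power_increasing) auto
    also have "\<dots> = exp 1" using n by (simp flip: exp_of_nat_mult)
    also have "\<dots> \<le> 3" by (rule exp_le)
    finally show ?thesis .
  qed
  \<comment> \<open>The case \<open>k = 1\<close> compares \<open>1 - 2 * s \<le> 2 * e\<close> with \<open>1 - 2 * t \<ge> e\<close>.\<close>
  have affine: "real k - real (Suc k) * s \<le> 5/2 * (real k - real (Suc k) * t)" if "1 \<le> k" for k
  proof (cases "k = 1")
    case True
    then show ?thesis using s' t' e by simp
  next
    case False
    have "real (Suc k) * (2/5) \<le> real (Suc k) * s" "real (Suc k) * t \<le> real (Suc k) * (1/2)"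
      using s' t' by (intro mult_left_mono; simp)+
    then show ?thesis using False that by (simp add: field_simps)
  qed
  have summand: "of_bool (ext v ! k) * ?d k s / s ^ ?n \<le> 15/2 * (of_bool (ext v ! k) * ?d k t / t ^ ?n)"
    if k: "k < ?n" for k
  proof (cases "k = 0")
    case True
    then have "\<not> ext v ! k" using w0 by (simp add: nth_append hd_conv_nth)
    then show ?thesis by simp
  next
    case False
    then have k1: "1 \<le> k" by simp
    have quot: "?d k u / u ^ ?n = (real k - real (Suc k) * u) / u ^ (?n + 1 - k)" if "0 < u" for u :: real
    proof -
      have "u ^ ?n = u ^ (k - 1) * u ^ (?n + 1 - k)" using k k1 by (simp flip: power_add)
      then show ?thesis unfolding deriv_term_factor[OF k1] using that by simp
    qed
    have "real (Suc k) * t \<le> real (Suc k) * (1/2)" using t' by (intro mult_left_mono) auto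
    also have "\<dots> \<le> real k" using k1 by simp
    finally have nn: "0 \<le> real k - real (Suc k) * t" by simp
    have "?d k s / s ^ ?n = (real k - real (Suc k) * s) / s ^ (?n + 1 - k)"
      using s' by (intro quot) auto
    also have "\<dots> \<le> 5/2 * (real k - real (Suc k) * t) / s ^ (?n + 1 - k)"
      using s' by (intro divide_right_mono affine k1) auto
    also have "\<dots> = 5/2 * ((real k - real (Suc k) * t) / t ^ (?n + 1 - k)) * (t / s) ^ (?n + 1 - k)"
      using t' s' by (simp add: power_divide)
    also have "\<dots> \<le> 5/2 * ((real k - real (Suc k) * t) / t ^ (?n + 1 - k)) * 3"
      using nn t' k1 by (intro mult_left_mono ratio) auto
    also have "\<dots> = 15/2 * (?d k t / t ^ ?n)" using quot[of t] t' by simp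
    finally show ?thesis by simp
  qed
  have split: "word_sum_deriv (ext v) u / u ^ ?n = (\<Sum>k<?n. of_bool (ext v ! k) * ?d k u / u ^ ?n)" for u
    unfolding word_sum_deriv_def sum_divide_distrib ..
  show ?thesis unfolding split sum_distrib_left using summand by (intro sum_mono) auto
qed

lemma bounded_distortion:
  assumes "s \<in> window" "t \<in> window" "s \<in> cylinder y (ext v)" "t \<in> cylinder y (ext v)"
  shows "speed y (ext v) s \<le> 15 * speed y (ext v) t"
  using deriv_ratio[OF assms] speed_bounds(2)[OF assms(1,3)] speed_bounds(1)[OF assms(2,4)]
  by linarith

section \<open>The nested construction for one point\<close>

text \<open>
  Cylinders containing a given nondegenerate interval have bounded word length, so a longest extension exists.
  For it neither digit can be appended on the whole interval. As the tail point falls at least as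
  fast as \<open>1 - t\<close>, the failure of digit \<open>0\<close> is visible at the left end and that of digit \<open>1\<close> at the right
  end.
\<close>

lemma maximal_extension:
  assumes ab: "a < b" "a \<in> window" "b \<in> window" and "{a..b} \<subseteq> cylinder y (ext v)"
  obtains v' where "{a..b} \<subseteq> cylinder y (ext (v @ v'))"
    "a < tail_point y (ext (v @ v')) a" "tail_point y (ext (v @ v')) b < 1 - b"
proof -
  define P where "P m \<longleftrightarrow> (\<exists>v'. length v' = m \<and> {a..b} \<subseteq> cylinder y (ext (v @ v')))" for m
  have "P 0" using assms(4) by (simp add: P_def)
  moreover have "m \<le> nat \<lceil>1 / (b - a)\<rceil>" if Pm: "P m" for m
  proof -
    obtain v' where v': "length v' = m" "{a..b} \<subseteq> cylinder y (ext (v @ v'))"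
      using Pm by (auto simp: P_def)
    have "real m \<le> 4 * real (length (ext (v @ v')))" using v' by simp
    then have "real m * (b - a) \<le> 4 * real (length (ext (v @ v'))) * \<bar>b - a\<bar>"
      using ab by (intro mult_mono) auto
    also have "\<dots> \<le> 1" using v' ab by (intro cylinder_short) auto
    finally have "real m * (b - a) \<le> 1" .
    then have "real m \<le> 1 / (b - a)" using ab by (simp add: field_simps)
    then show ?thesis by linarith
  qed
  ultimately obtain m where m: "P m" "\<And>m'. P m' \<Longrightarrow> m' \<le> m"
    using Nat.ex_has_greatest_nat[of P 0 "nat \<lceil>1 / (b - a)\<rceil>"] by blast
  then obtain v' where v': "length v' = m" "{a..b} \<subseteq> cylinder y (ext (v @ v'))"
    unfolding P_def by blast
  let ?u = "ext (v @ v')"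
  have in_window: "t \<in> window" if "t \<in> {a..b}" for t using window_between[OF ab(2,3)] that by auto
  have stuck: "\<not> {a..b} \<subseteq> cylinder y (?u @ [d])" for d
  proof
    assume "{a..b} \<subseteq> cylinder y (?u @ [d])"
    then have "P (Suc m)" using v'(1) unfolding P_def by (intro exI[of _ "v' @ [d]"]) simp
    then show False using m(2)[of "Suc m"] by simp
  qed
  have dec: "t - s \<le> tail_point y ?u s - tail_point y ?u t" if "s \<in> {a..b}" "t \<in> {a..b}" "s \<le> t" for s t
    using fall_ge_width[of s t "v @ v'"] that v'(2) in_window by blast
  have "a < tail_point y ?u a"
  proof (rule ccontr)
    assume le: "\<not> a < tail_point y ?u a"
    have "t \<in> cylinder y (?u @ [False])" if t: "t \<in> {a..b}" for t
    proof -
      have "0 < t" using windowD[OF in_window[OF t]] by simp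
      moreover have "tail_point y ?u t \<le> t" using dec[of a t] t le ab by auto
      ultimately show ?thesis using v'(2) t by (auto simp: cylinder_def tail_point_snoc simp del: append_assoc)
    qed
    then show False using stuck by blast
  qed
  moreover have "tail_point y ?u b < 1 - b"
  proof (rule ccontr)
    assume ge: "\<not> tail_point y ?u b < 1 - b"
    have "t \<in> cylinder y (?u @ [True])" if t: "t \<in> {a..b}" for t
    proof -
      have "0 < t" using windowD[OF in_window[OF t]] by simp
      moreover have "1 - t \<le> tail_point y ?u t" using dec[of t b] t ge ab by auto
      moreover have "tail_point y ?u t \<le> 1" using v'(2) t by (auto simp: cylinder_def)
      ultimately show ?thesis by (simp add: cylinder_def tail_point_snoc del: append_assoc)
    qed
    then show False using stuck by blast
  qed
  ultimately show ?thesis using that v'(2) by blast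
qed

text \<open>
  The two inequalities at the ends express that the word cannot be prolonged on the whole interval
  (see \<open>maximal_extension\<close>).
\<close>

definition stage :: "nat \<Rightarrow> real \<Rightarrow> real \<Rightarrow> bool" where
  "stage k a b \<longleftrightarrow> a < b \<and> a \<in> window \<and> b \<in> window \<and>
     (\<exists>v. k \<le> length v \<and> {a..b} \<subseteq> cylinder y (ext v) \<and>
        a < tail_point y (ext v) a \<and> tail_point y (ext v) b < 1 - b \<and>
        (\<forall>s \<in> {a..b} \<inter> hole y (ext v). \<forall>t \<in> {a..b} \<inter> hole y (ext v). \<bar>s - t\<bar> \<le> (b - a) / real N))"

lemma mem_Lambda_of_stages:
  assumes "\<And>k. \<exists>a b. stage k a b \<and> x \<in> {a..b}"
  shows "x \<in> Lambda y"
proof (rule mem_LambdaI)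
  obtain a b where "stage 0 a b" "x \<in> {a..b}" using assms by blast
  then have "x \<in> window" using window_between[of a b x] by (auto simp: stage_def)
  then show "0 < x" "x \<le> 1/2" using windowD[of x] by auto
  fix n
  obtain a b where "stage n a b" "x \<in> {a..b}" using assms by blast
  then obtain v where "n \<le> length v" "x \<in> cylinder y (ext v)" by (auto simp: stage_def)
  then show "\<exists>w. n \<le> length w \<and> x \<in> cylinder y w" using length_ext(2)[of v] le_trans by blast
qed

text \<open>
  Across a hole the tail point falls from below \<open>1 - s\<close> to above \<open>t\<close>, hence by at most
  \<open>2 * e\<close>, the bound for the central gap.
\<close>

lemma hole_width:
  assumes "s \<in> window" "t \<in> window" "s \<in> cylinder y (ext v)" "t \<in> cylinder y (ext v)"
    and hole: "s \<in> hole y (ext v)" "t \<in> hole y (ext v)" and "s < t"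
  obtains x where "x \<in> window" "x \<in> cylinder y (ext v)" "(t - s) * speed y (ext v) x \<le> 2 * e"
proof -
  obtain x where x: "x \<in> window" "x \<in> cylinder y (ext v)"
      "tail_point y (ext v) s - tail_point y (ext v) t = (t - s) * speed y (ext v) x"
    using window_fall[OF assms(1-4,7)] by metis
  have "tail_point y (ext v) s - tail_point y (ext v) t \<le> (1 - s) - t" using hole by (auto simp: hole_def)
  also have "\<dots> \<le> 2 * e" using windowD[OF assms(1)] windowD[OF assms(2)] by linarith
  finally show ?thesis using that x by simp
qed

text \<open>
  On the window the gap to be crossed has size at most \<open>2 * e\<close> and the tail point falls at speed
  at least \<open>4 * N\<close>, so the hole is at most \<open>e / (2 * N)\<close> long; the window has length \<open>e / 2\<close>. This is the
  reason for the constant \<open>4\<close> in the steepness condition.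
\<close>

lemma stage_zero: "stage 0 (1/2 - e) (1/2 - e/2)"
proof -
  let ?a = "1/2 - e" and ?b = "1/2 - e/2"
  have ab: "?a < ?b" "?a \<in> window" "?b \<in> window" using e by (auto simp: window_def)
  have "{?a..?b} \<subseteq> cylinder y (ext [])" using seed by auto
  from maximal_extension[OF ab this] obtain v where
    v: "{?a..?b} \<subseteq> cylinder y (ext v)" "?a < tail_point y (ext v) ?a" "tail_point y (ext v) ?b < 1 - ?b"
    by (metis append_Nil)
  have width: "t - s \<le> (?b - ?a) / real N"
    if s: "s \<in> {?a..?b}" "s \<in> hole y (ext v)" and t: "t \<in> {?a..?b}" "t \<in> hole y (ext v)" for s t
  proof (cases "s < t")
    case True
    have "s \<in> window" "t \<in> window" "s \<in> cylinder y (ext v)" "t \<in> cylinder y (ext v)"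
      using s t v(1) by (auto simp: window_def)
    then obtain x where x: "x \<in> window" "x \<in> cylinder y (ext v)" "(t - s) * speed y (ext v) x \<le> 2 * e"
      using hole_width s t True by metis
    have "4 * real N * 1 \<le> 4 * real N * real (length (ext v))"
      using length_ext(1)[of v] by (intro mult_left_mono) auto
    then have "4 * real N \<le> speed y (ext v) x" using speed_ge[OF x(1,2)] by linarith
    then have "(t - s) * (4 * real N) \<le> (t - s) * speed y (ext v) x"
      using True by (intro mult_left_mono) auto
    then show ?thesis using x(3) N by (simp add: field_simps)
  next
    case False
    moreover have "0 \<le> (?b - ?a) / real N" using e by simp
    ultimately show ?thesis by linarith
  qed
  show ?thesis unfolding stage_def
    using ab v width by (intro conjI exI[of _ v] ballI) (auto simp: abs_le_iff simp del: divide_le_eq)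
qed

text \<open>
  If the larger interval leaves the cylinder on the left, then on it the tail point falls from \<open>1\<close>
  to below \<open>1 - b'\<close>, that is, through the whole cylinder of the next digit \<open>1\<close>; if it leaves on
  the right, the tail point falls from above \<open>a'\<close> to \<open>0\<close>. Either way it falls by at least \<open>2/5\<close>,
  the lower bound for the parameters of the window.
\<close>

lemma long_of_overrun:
  assumes ab: "a < b" "a \<in> window" "b \<in> window" and sub: "a \<le> a'" "a' < b'" "b' \<le> b"
    and in_cyl: "{a'..b'} \<subseteq> cylinder y (ext v)"
    and crosses: "a' < tail_point y (ext v) a'" "tail_point y (ext v) b' < 1 - b'"
    and out: "1 < tail_point y (ext v) a \<or> tail_point y (ext v) b < 0"
  obtains x where "x \<in> window" "x \<in> cylinder y (ext v)" "2/5 \<le> (b - a) * speed y (ext v) x"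
proof -
  have in_window: "t \<in> window" if "a \<le> t" "t \<le> b" for t using window_between[OF ab(2,3)] that by auto
  have pos: "0 < a" using windowD[OF ab(2)] by simp
  have long: "\<exists>x. x \<in> window \<and> x \<in> cylinder y (ext v) \<and> 2/5 \<le> (b - a) * speed y (ext v) x" if st: "a \<le> s" "s < t" "t \<le> b" "s \<in> cylinder y (ext v)" "t \<in> cylinder y (ext v)"
      and fall: "2/5 \<le> tail_point y (ext v) s - tail_point y (ext v) t" for s t
  proof -
    have "s \<in> window" "t \<in> window" using in_window st by auto
    then obtain x where x: "x \<in> window" "x \<in> cylinder y (ext v)"
        "tail_point y (ext v) s - tail_point y (ext v) t = (t - s) * speed y (ext v) x"
      using window_fall[of s t v] st by metis
    have "0 \<le> speed y (ext v) x" using speed_ge[OF x(1,2)] by (rule order_trans[rotated]) simp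
    then have "(t - s) * speed y (ext v) x \<le> (b - a) * speed y (ext v) x"
      using st by (intro mult_right_mono) auto
    then show ?thesis using x fall by auto
  qed
  from out have "\<exists>x. x \<in> window \<and> x \<in> cylinder y (ext v) \<and> 2/5 \<le> (b - a) * speed y (ext v) x"
  proof
    assume "1 < tail_point y (ext v) a"
    then obtain s where s: "a \<le> s" "s \<le> b'" "tail_point y (ext v) s = 1"
      using IVT2'[of "tail_point y (ext v)" b' 1 a] continuous_on_tail_point[OF pos, of b' y "ext v"]
        crosses windowD[OF in_window[of b']] sub by auto
    have "b' \<in> cylinder y (ext v)" using in_cyl sub by auto
    moreover have "s \<noteq> b'" using s crosses windowD[OF in_window[of b']] sub by auto
    moreover have "2/5 \<le> tail_point y (ext v) s - tail_point y (ext v) b'"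
      using s crosses windowD[OF in_window[of b']] sub by auto
    ultimately show ?thesis using s sub by (intro long[of s b']) (auto simp: cylinder_def)
  next
    assume "tail_point y (ext v) b < 0"
    then obtain t where t: "a' \<le> t" "t \<le> b" "tail_point y (ext v) t = 0"
      using IVT2'[of "tail_point y (ext v)" b 0 a'] continuous_on_tail_point[of a' b y "ext v"] pos
        crosses sub by auto
    have "a' \<in> cylinder y (ext v)" using in_cyl sub by auto
    moreover have "t \<noteq> a'" using t crosses pos sub by auto
    moreover have "2/5 \<le> tail_point y (ext v) a' - tail_point y (ext v) t"
      using t crosses windowD[OF in_window[of a']] sub by auto
    ultimately show ?thesis using t sub by (intro long[of a' t]) (auto simp: cylinder_def)
  qed
  then show ?thesis using that by blast
qed

text \<open>
  On an interval that misses the hole the next digit is constant: if digit \<open>1\<close> were forced at the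
  left end and digit \<open>0\<close> at the right end, the tail point would take the value \<open>1/2\<close> in between, at a
  parameter of the hole.
\<close>

lemma child_avoiding_hole:
  assumes in_window: "a' \<in> window" "b' \<in> window" and ab: "a' < b'" and in_cyl: "{a'..b'} \<subseteq> cylinder y (ext v)"
    and avoid: "{a'..b'} \<inter> hole y (ext v) = {}"
  obtains d where "{a'..b'} \<subseteq> cylinder y (ext (v @ [d]))"
proof -
  let ?x = "tail_point y (ext v)"
  have window: "t \<in> window" if "t \<in> {a'..b'}" for t using window_between[OF in_window] that by auto
  have dec: "t - s \<le> ?x s - ?x t" if "s \<in> {a'..b'}" "t \<in> {a'..b'}" "s \<le> t" for s t
    using fall_ge_width[of s t v] that in_cyl window by blast
  have dich: "?x t \<le> t \<or> 1 - t \<le> ?x t" if "t \<in> {a'..b'}" for t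
    using avoid that by (force simp: hole_def)
  consider "?x a' \<le> a'" | "1 - b' \<le> ?x b'" | "1 - a' \<le> ?x a'" "?x b' \<le> b'"
    using dich[of a'] dich[of b'] ab by auto
  then show ?thesis
  proof cases
    case 1
    have "t \<in> cylinder y (ext v @ [False])" if t: "t \<in> {a'..b'}" for t
    proof -
      have "0 < t" using windowD[OF window[OF t]] by simp
      moreover have "?x t \<le> t" using dec[of a' t] t 1 ab by auto
      ultimately show ?thesis using in_cyl t by (auto simp: cylinder_def tail_point_snoc simp del: append_assoc)
    qed
    then have "{a'..b'} \<subseteq> cylinder y (ext (v @ [False]))" by auto
    then show ?thesis by (rule that)
  next
    case 2
    have "t \<in> cylinder y (ext v @ [True])" if t: "t \<in> {a'..b'}" for t
    proof -
      have "0 < t" using windowD[OF window[OF t]] by simp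
      moreover have "1 - t \<le> ?x t" using dec[of t b'] t 2 ab by auto
      moreover have "?x t \<le> 1" using in_cyl t by (auto simp: cylinder_def)
      ultimately show ?thesis by (simp add: cylinder_def tail_point_snoc del: append_assoc)
    qed
    then have "{a'..b'} \<subseteq> cylinder y (ext (v @ [True]))" by auto
    then show ?thesis by (rule that)
  next
    case 3
    have half: "a' < 1/2" "b' < 1/2" "0 < a'" using windowD in_window by force+
    then obtain t where t: "a' \<le> t" "t \<le> b'" "?x t = 1/2"
      using IVT2'[of ?x b' "1/2" a'] continuous_on_tail_point[of a' b' y "ext v"] 3 ab by auto
    then show ?thesis using dich[of t] half by auto
  qed
qed

text \<open>
  The set \<open>H\<close> is the part of the hole of the current word inside \<open>[a, b]\<close>. A piece that
  misses it gets at least one more digit, and its maximal word \<open>u\<close> is not admissible on all of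
  \<open>[a, b]\<close>, so that \<open>[a, b]\<close> is long compared with the inverse speed of \<open>u\<close>, while the hole
  of \<open>u\<close> is short compared with it.
\<close>

lemma stage_Suc:
  assumes "stage k a b"
  obtains H where "\<And>s t. s \<in> H \<Longrightarrow> t \<in> H \<Longrightarrow> \<bar>s - t\<bar> \<le> (b - a) / real N"
    and "\<And>a' b'. a \<le> a' \<Longrightarrow> b' \<le> b \<Longrightarrow> b' - a' = (b - a) / real N \<Longrightarrow> {a'..b'} \<inter> H = {} \<Longrightarrow>
      stage (Suc k) a' b'"
proof -
  obtain v where ab: "a < b" "a \<in> window" "b \<in> window" and v: "k \<le> length v" "{a..b} \<subseteq> cylinder y (ext v)"
    and stuck: "a < tail_point y (ext v) a" "tail_point y (ext v) b < 1 - b"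
    and width: "\<forall>s \<in> {a..b} \<inter> hole y (ext v). \<forall>t \<in> {a..b} \<inter> hole y (ext v).
      \<bar>s - t\<bar> \<le> (b - a) / real N"
    using assms unfolding stage_def by blast
  show ?thesis
  proof (rule that[of "{a..b} \<inter> hole y (ext v)"])
    show "\<bar>s - t\<bar> \<le> (b - a) / real N"
      if "s \<in> {a..b} \<inter> hole y (ext v)" "t \<in> {a..b} \<inter> hole y (ext v)" for s t
      using width that by blast
  next
    fix a' b' assume sub: "a \<le> a'" "b' \<le> b" and len: "b' - a' = (b - a) / real N"
      and avoid: "{a'..b'} \<inter> ({a..b} \<inter> hole y (ext v)) = {}"
    have "0 < b' - a'" unfolding len using ab N by simp
    then have ab': "a' < b'" by simp
    have in_window: "t \<in> window" if "a \<le> t" "t \<le> b" for t using window_between[OF ab(2,3)] that by auto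
    have win': "a' \<in> window" "b' \<in> window" using in_window sub ab' by auto
    have "{a'..b'} \<subseteq> cylinder y (ext v)" "{a'..b'} \<inter> hole y (ext v) = {}"
      using v(2) avoid sub by auto
    then obtain d where d: "{a'..b'} \<subseteq> cylinder y (ext (v @ [d]))"
      using child_avoiding_hole[OF win' ab'] by metis
    obtain v' where u: "{a'..b'} \<subseteq> cylinder y (ext (v @ [d] @ v'))"
      "a' < tail_point y (ext (v @ [d] @ v')) a'" "tail_point y (ext (v @ [d] @ v')) b' < 1 - b'"
      using maximal_extension[OF ab' win' d] by auto
    define u where "u = v @ [d] @ v'"
    note u = u[folded u_def]
    have ext_u: "ext u = (ext v @ [d]) @ v'" by (simp add: u_def)
    have pos: "0 < a" "a \<le> 1" "0 < b" "b \<le> 1" using windowD ab by force+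
    \<comment> \<open>The maximality of \<open>v\<close> on \<open>[a, b]\<close> rules out digit \<open>0\<close> at \<open>a\<close> and digit \<open>1\<close> at \<open>b\<close>.\<close>
    have out: "1 < tail_point y (ext u) a \<or> tail_point y (ext u) b < 0"
    proof (rule ccontr)
      assume "\<not> ?thesis"
      then have "tail_point y (ext v @ [d]) a \<le> 1" "0 \<le> tail_point y (ext v @ [d]) b"
        using tail_point_append_bounds(2)[OF pos(1,2), of y "ext v @ [d]" v']
          tail_point_append_bounds(1)[OF pos(3,4), of y "ext v @ [d]" v'] by (auto simp: ext_u)
      then show False using stuck pos
        by (cases d) (auto simp: tail_point_snoc zero_le_divide_iff simp del: append_assoc)
    qed
    obtain x where x: "x \<in> window" "x \<in> cylinder y (ext u)" "2/5 \<le> (b - a) * speed y (ext u) x"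
      using long_of_overrun[OF ab sub(1) ab' sub(2) u out] by blast
    have width': "t - s \<le> (b' - a') / real N"
      if s: "s \<in> {a'..b'}" "s \<in> hole y (ext u)" and t: "t \<in> {a'..b'}" "t \<in> hole y (ext u)" for s t
    proof (cases "s < t")
      case True
      have "s \<in> window" "t \<in> window" "s \<in> cylinder y (ext u)" "t \<in> cylinder y (ext u)"
        using in_window sub s t u(1) by auto
      then obtain z where z: "z \<in> window" "z \<in> cylinder y (ext u)" "(t - s) * speed y (ext u) z \<le> 2 * e"
        using hole_width s t True by metis
      define p q where "p = speed y (ext u) x" and "q = speed y (ext u) z"
      have pq: "p \<le> 15 * q"
        unfolding p_def q_def by (rule bounded_distortion[OF x(1) z(1) x(2) z(2)])
      have "0 < (b - a) * p" using x(3) by (simp add: p_def)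
      then have p: "0 < p" using ab by (simp add: zero_less_mult_iff)
      \<comment> \<open>The speed \<open>p\<close> controls the length of \<open>[a, b]\<close> from below, the speed \<open>q\<close> that of the hole from above.\<close>
      have "(t - s) * p \<le> (t - s) * (15 * q)" using pq True by (intro mult_left_mono) auto
      also have "\<dots> \<le> 30 * e" using z(3) by (simp add: q_def)
      also have "\<dots> \<le> 75 * e * ((b - a) * p)"
        using mult_left_mono[OF x(3), of "75 * e"] e(1) by (simp add: p_def)
      finally have "(t - s) * p \<le> (75 * e * (b - a)) * p" by (simp add: mult.assoc)
      then have "t - s \<le> 75 * e * (b - a)" using p by simp
      also have "\<dots> \<le> 1 / real N ^ 2 * (b - a)"
      proof (rule mult_right_mono)
        have "75 * e \<le> 100 * e" using e by simp
        also have "\<dots> \<le> 1 / real N ^ 2" using e(2) N by (simp add: field_simps)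
        finally show "75 * e \<le> 1 / real N ^ 2" .
      qed (use ab in simp)
      also have "\<dots> = (b' - a') / real N" unfolding len by (simp add: power2_eq_square)
      finally show ?thesis .
    next
      case False
      moreover have "0 \<le> (b' - a') / real N" using ab' by simp
      ultimately show ?thesis by linarith
    qed
    have "Suc k \<le> length u" using v(1) by (simp add: u_def)
    then show "stage (Suc k) a' b'" unfolding stage_def using ab' win' u width'
      by (intro conjI exI[of _ u] ballI) (auto simp: abs_le_iff)
  qed
qed

end

section \<open>Initial words\<close>

text \<open>
  At \<open>t = 1/2\<close> the pieces of each level are consecutive intervals of equal length, and words code
  binary expansions. The strict right inequality makes the word admissible also slightly below
  \<open>1/2\<close>.
\<close>

lemma binary_digits:
  assumes "0 \<le> y" "y < 1/2"
  shows "\<exists>w. length w = Suc n \<and> \<not> hd w \<and> word_sum w (1/2) \<le> y \<and> y < word_sum w (1/2) + (1/2) ^ Suc n"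
proof (induction n)
  case 0
  then show ?case using assms by (intro exI[of _ "[False]"]) (simp add: word_sum_def)
next
  case (Suc n)
  then obtain w where w: "length w = Suc n" "\<not> hd w" "word_sum w (1/2) \<le> y"
    "y < word_sum w (1/2) + (1/2) ^ Suc n" by blast
  define d where "d \<longleftrightarrow> word_sum w (1/2) + (1/2) ^ Suc (Suc n) \<le> y"
  have "\<not> hd (w @ [d])" using w by (cases w) auto
  then show ?case using w by (intro exI[of _ "w @ [d]"]) (auto simp: word_sum_snoc d_def)
qed

text \<open>
  At \<open>t = 1/2\<close> the digit with index \<open>k\<close> contributes \<open>(k - 1) / 2 ^ k\<close> to the derivative and
  \<open>1 / 2 ^ (k + 1)\<close> to the sum. The digit with index \<open>1\<close> contributes nothing to the derivative, which explains the correction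
  term.
\<close>

lemma word_sum_deriv_half_ge:
  assumes "w \<noteq> []" "\<not> hd w"
  shows "2 * word_sum w (1/2) - (if 1 < length w \<and> w ! 1 then 1/2 else 0) \<le> word_sum_deriv w (1/2)"
proof -
  let ?n = "length w"
  let ?c = "if w ! 1 then 1/2 else (0::real)"
  have "2 * word_sum w (1/2) - (if 1 < ?n \<and> w ! 1 then 1/2 else 0) =
      (\<Sum>k<?n. of_bool (w ! k) * (1/2) ^ k - (if k = 1 then ?c else 0))"
    by (simp add: word_sum_def sum_subtractf sum_distrib_left)
  also have "\<dots> \<le> word_sum_deriv w (1/2)" unfolding word_sum_deriv_def
  proof (rule sum_mono)
    fix k
    consider "k = 0" | "k = 1" | m where "k = Suc (Suc m)" by (metis One_nat_def not0_implies_Suc)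
    then show "of_bool (w ! k) * (1/2) ^ k - (if k = 1 then ?c else 0)
      \<le> of_bool (w ! k) * (real k * (1/2) ^ (k - 1) - real (Suc k) * (1/2) ^ k)"
    proof cases
      case 1
      then have "\<not> w ! k" using assms by (simp add: hd_conv_nth)
      then show ?thesis using 1 by simp
    next
      case 3
      have "real k * (1/2) ^ (k - 1) - real (Suc k) * (1/2) ^ k = (real m + 1) * (1/2) ^ k"
        unfolding 3 by (simp add: field_simps)
      moreover have "1 * (1/2) ^ k \<le> (real m + 1) * (1/2::real) ^ k" by (intro mult_right_mono) auto
      ultimately show ?thesis using 3 by (cases "w ! k") (simp_all del: power_Suc)
    qed simp
  qed
  finally show ?thesis .
qed

text \<open>
  For \<open>y \<noteq> 1/4\<close> long binary expansions have a derivative at \<open>1/2\<close> that is bounded below by a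
  positive constant, so dividing by \<open>t ^ n\<close> beats every multiple of \<open>n\<close>. Both conditions then extend to
  the left of \<open>1/2\<close>: the upper bound for \<open>y\<close> and the steepness by continuity, the lower bound by monotonicity.
\<close>

lemma seeded_at_half:
  assumes y: "0 < y" "y < 1/2" "y \<noteq> 1/4"
  obtains w where "w \<noteq> []" "\<not> hd w" "\<forall>\<^sub>F t in at_left (1/2). t \<in> cylinder y w"
    "\<forall>\<^sub>F t in at_left (1/2). Q * real (length w) \<le> word_sum_deriv w t / t ^ length w"
proof -
  \<comment> \<open>If \<open>y < 1/4\<close>, the digit with index \<open>1\<close> is \<open>0\<close> and there is no correction term.\<close>
  define c where "c = (if y < 1/4 then y else y - 1/4)"
  have c: "0 < c" using y by (auto simp: c_def)
  have "\<forall>\<^sub>F n in sequentially. Q * real (Suc n) < 2 * (c * 2 ^ Suc n - 1)"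
    using c by real_asymp
  from eventually_happens'[OF sequentially_bot this] obtain n where n: "Q * real (Suc n) < 2 * (c * 2 ^ Suc n - 1)"
    by blast
  obtain w where w: "length w = Suc n" "\<not> hd w" "word_sum w (1/2) \<le> y"
    "y < word_sum w (1/2) + (1/2) ^ Suc n" using binary_digits[of y n] y by auto
  have w_ne: "w \<noteq> []" using w by auto
  have cont: "((\<lambda>t. word_sum w t) \<longlongrightarrow> word_sum w (1/2)) (at_left (1/2))"
  proof -
    have "isCont (word_sum w) (1/2)" by (rule DERIV_isCont[OF has_real_derivative_word_sum])
    then show ?thesis by (simp add: isCont_def filterlim_at_split)
  qed
  have near: "\<forall>\<^sub>F t in at_left (1/2). 0 < t \<and> t < (1/2::real)"
    by (rule eventually_at_leftI[of 0]) auto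
  have "((\<lambda>t. word_sum w t + t ^ Suc n) \<longlongrightarrow> word_sum w (1/2) + (1/2) ^ Suc n) (at_left (1/2))"
    by (intro tendsto_intros cont)
  from order_tendstoD(1)[OF this w(4)] near
  have "\<forall>\<^sub>F t in at_left (1/2). t \<in> cylinder y w"
  proof eventually_elim
    case (elim t)
    then have "word_sum w t \<le> y" using word_sum_mono[OF w_ne w(2), of t "1/2"] w(3) by auto
    then show ?case using elim w(1) by (simp add: cylinder_def tail_point_def del: power_Suc)
  qed
  moreover have "\<forall>\<^sub>F t in at_left (1/2). Q * real (length w) \<le> word_sum_deriv w t / t ^ length w"
  proof -
    have "((\<lambda>t. word_sum_deriv w t / t ^ length w) \<longlongrightarrow> word_sum_deriv w (1/2) / (1/2) ^ length w)
        (at_left (1/2))"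
      unfolding word_sum_deriv_def by (intro tendsto_intros) auto
    moreover have "Q * real (length w) < word_sum_deriv w (1/2) / (1/2) ^ length w"
    proof -
      have "1/4 \<le> word_sum w (1/2)" if one: "1 < length w" "w ! 1"
      proof -
        have "(\<Sum>k\<in>{1}. of_bool (w ! k) * ((1 - 1/2) * (1/2) ^ k)) \<le> word_sum w (1/2)"
          unfolding word_sum_def using one by (intro sum_mono2) auto
        then show ?thesis using one by simp
      qed
      then have "2 * (c - (1/2) ^ Suc n) \<le> word_sum_deriv w (1/2)"
        using word_sum_deriv_half_ge[OF w_ne w(2)] w(3,4) by (auto simp: c_def split: if_splits)
      then have "2 * (c - (1/2) ^ Suc n) * 2 ^ Suc n \<le> word_sum_deriv w (1/2) * 2 ^ Suc n"
        by (intro mult_right_mono) auto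
      moreover have "2 * (c - (1/2) ^ Suc n) * 2 ^ Suc n = 2 * (c * 2 ^ Suc n - 1)"
        by (simp add: algebra_simps power_one_over)
      ultimately have "Q * real (Suc n) < word_sum_deriv w (1/2) * 2 ^ Suc n" using n by linarith
      also have "\<dots> = word_sum_deriv w (1/2) / (1/2) ^ length w"
        unfolding w(1) power_one_over by simp
      finally show ?thesis by (simp only: w(1))
    qed
    ultimately have "\<forall>\<^sub>F t in at_left (1/2).
        Q * real (length w) < word_sum_deriv w t / t ^ length w"
      by (rule order_tendstoD(1))
    then show ?thesis by (rule eventually_mono) simp
  qed
  ultimately show ?thesis using that w_ne w(2) by blast
qed

lemma eventually_window:
  assumes "\<forall>\<^sub>F t in at_left (1/2). P t"
  shows "\<forall>\<^sub>F q in sequentially. \<forall>t \<in> {1/2 - (1/4) ^ q..1/2 - (1/4) ^ q / 2}. P (t::real)"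
proof -
  obtain b where b: "b < 1/2" "\<And>t. b < t \<Longrightarrow> t < 1/2 \<Longrightarrow> P t"
    using assms unfolding eventually_at_left[of 0 "1/2::real", simplified] by auto
  have "(\<lambda>q. (1/4::real) ^ q) \<longlonglongrightarrow> 0" by (intro LIMSEQ_power_zero) auto
  then have "\<forall>\<^sub>F q in sequentially. (1/4::real) ^ q < 1/2 - b"
    using b(1) by (intro order_tendstoD(2)) auto
  then show ?thesis
  proof eventually_elim
    case (elim q)
    define h where "h = (1/4::real) ^ q"
    have "0 < h" "h < 1/2 - b" using elim by (simp_all add: h_def)
    then show ?case unfolding h_def[symmetric] by (auto intro!: b(2))
  qed
qed

text \<open>
  For \<open>y = 1/4\<close> the word \<open>01000...\<close> has tail point \<open>(1/2 - t)\<^sup>2 / t ^ n\<close> and derivative \<open>1 - 2 * t\<close>.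
  With \<open>1/2 - t\<close> of order \<open>e = 4 powr (- q)\<close>, the tail point stays below \<open>1\<close> roughly up to \<open>n = 4 * q\<close>, while
  steepness requires \<open>n\<close> to exceed \<open>2 * q\<close> by enough. The choice \<open>n = 3 * q\<close> lies in between.
\<close>

lemma seed_quarter:
  assumes q: "2 \<le> q" and large: "3 * Q * real q \<le> 2 ^ q"
  defines "w \<equiv> False # True # replicate (3 * q - 2) False"
  assumes t: "t \<in> {1/2 - (1/4) ^ q..1/2 - (1/4) ^ q / 2}"
  shows "t \<in> cylinder (1/4) w" "Q * real (length w) \<le> word_sum_deriv w t / t ^ length w"
proof -
  define h where "h = (1/4::real) ^ q"
  have "h \<le> (1/4) ^ 2" unfolding h_def using q by (intro power_decreasing) auto
  then have h: "0 < h" "h \<le> 1/16" by (simp_all add: h_def power2_eq_square)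
  have t': "2/5 \<le> t" "t \<le> 1/2" "1/2 - t \<le> h" "h \<le> 1 - 2 * t" "0 \<le> 1/2 - t"
    using t h by (auto simp flip: h_def)
  have len: "length w = 3 * q" using q by (simp add: w_def)
  have digit: "w ! k \<longleftrightarrow> k = 1" if "k < 3 * q" for k
    using that q by (auto simp: w_def nth_Cons split: nat.split)
  have "word_sum w t = (\<Sum>k<3 * q. if k = 1 then (1 - t) * t else 0)"
    unfolding word_sum_def len using digit by (intro sum.cong) auto
  then have "word_sum w t = (1 - t) * t" using q by simp
  then have ex: "tail_point (1/4) w t = (1/2 - t)\<^sup>2 / t ^ (3 * q)"
    by (simp add: tail_point_def len power2_eq_square algebra_simps)
  have "(1/2 - t)\<^sup>2 \<le> h\<^sup>2" using t' by (intro power_mono) auto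
  also have "\<dots> = (1/16) ^ q" by (simp add: h_def power2_eq_square flip: power_mult_distrib)
  \<comment> \<open>Here \<open>n = 3 * q\<close> is not too long: \<open>1/16 \<le> (2/5) ^ 3\<close>.\<close>
  also have "\<dots> \<le> ((2/5) ^ 3) ^ q" by (intro power_mono) (auto simp: power3_eq_cube)
  also have "\<dots> \<le> t ^ (3 * q)" unfolding power_mult[symmetric] using t' by (intro power_mono) auto
  finally show "t \<in> cylinder (1/4) w" using t' by (simp add: cylinder_def ex)
  have "word_sum_deriv w t = (\<Sum>k<3 * q. if k = 1 then 1 - 2 * t else 0)"
    unfolding word_sum_deriv_def len using digit by (intro sum.cong) auto
  then have deriv: "word_sum_deriv w t = 1 - 2 * t" using q by simp
  have "Q * real (length w) \<le> 2 ^ q" using large by (simp add: len mult_ac)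
  also have "\<dots> = h / (1/2) ^ (3 * q)"
  proof -
    have "2 ^ q * ((1/2) ^ 3) ^ q = (2 * (1/2) ^ 3 :: real) ^ q" by (rule power_mult_distrib[symmetric])
    also have "2 * (1/2) ^ 3 = (1/4::real)" by (simp add: power3_eq_cube)
    finally have "h = 2 ^ q * (1/2) ^ (3 * q)" by (simp only: h_def power_mult)
    then show ?thesis by simp
  qed
  also have "\<dots> \<le> (1 - 2 * t) / t ^ (3 * q)"
    using t' h by (intro frac_le power_mono) auto
  finally show "Q * real (length w) \<le> word_sum_deriv w t / t ^ length w" by (simp add: deriv len)
qed

lemma eventually_seeded_window:
  assumes y: "0 < y" "y < 1/2" and N: "1 \<le> N"
  shows "\<forall>\<^sub>F q in sequentially. \<exists>w. seeded_window y ((1/4) ^ q) w N"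
proof -
  have "(\<lambda>q. (1/4::real) ^ q) \<longlonglongrightarrow> 0" by (intro LIMSEQ_power_zero) auto
  then have small: "\<forall>\<^sub>F q in sequentially. (1/4::real) ^ q < 1 / (100 * real N ^ 2)"
    using N by (intro order_tendstoD(2)) auto
  show ?thesis
  proof (cases "y = 1/4")
    case True
    have "\<forall>\<^sub>F q in sequentially. 3 * (4 * real N) * real q \<le> 2 ^ q" by real_asymp
    with small eventually_ge_at_top[of 2] show ?thesis
    proof eventually_elim
      case (elim q)
      have "seeded_window y ((1/4) ^ q) (False # True # replicate (3 * q - 2) False) N"
      proof
        fix t :: real assume t: "t \<in> {1/2 - (1/4) ^ q..1/2 - (1/4) ^ q / 2}"
        note seed = seed_quarter[OF elim(2) elim(3) t]
        show "t \<in> cylinder y (False # True # replicate (3 * q - 2) False)"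
          unfolding True by (rule seed(1))
        show "4 * real N * real (length (False # True # replicate (3 * q - 2) False))
          \<le> word_sum_deriv (False # True # replicate (3 * q - 2) False) t /
            t ^ length (False # True # replicate (3 * q - 2) False)"
          by (rule seed(2))
      qed (use elim N in simp_all)
      then show ?case ..
    qed
  next
    case False
    obtain w where w: "w \<noteq> []" "\<not> hd w" "\<forall>\<^sub>F t in at_left (1/2). t \<in> cylinder y w"
      "\<forall>\<^sub>F t in at_left (1/2). 4 * real N * real (length w) \<le> word_sum_deriv w t / t ^ length w"
      by (rule seeded_at_half[OF y False])
    from small eventually_window[OF w(3)] eventually_window[OF w(4)] show ?thesis
    proof eventually_elim
      case (elim q)
      have "seeded_window y ((1/4) ^ q) w N"
      proof
        fix t :: real assume t: "t \<in> {1/2 - (1/4) ^ q..1/2 - (1/4) ^ q / 2}"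
        show "t \<in> cylinder y w" using elim(2) t by blast
        show "4 * real N * real (length w) \<le> word_sum_deriv w t / t ^ length w"
          using elim(3) t by blast
      qed (use elim N w in simp_all)
      then show ?case ..
    qed
  qed
qed

section \<open>Hausdorff measure of sets with many branches\<close>

text \<open>
  Consecutive closed pieces share endpoints, so a set no longer than a piece can touch three of
  them. The lemma serves both for the holes and for the sets of a cover.
\<close>

lemma card_pieces_meeting_short_set:
  fixes a l :: real
  assumes l: "0 < l" and short: "\<And>s t. s \<in> H \<Longrightarrow> t \<in> H \<Longrightarrow> \<bar>s - t\<bar> \<le> l"
  shows "card {j \<in> {..<N}. {a + real j * l..a + real (Suc j) * l} \<inter> H \<noteq> {}} \<le> 3"
proof -
  define Z where "Z = {j \<in> {..<N}. {a + real j * l..a + real (Suc j) * l} \<inter> H \<noteq> {}}"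
  have near: "j \<le> i + 2" if ij: "i \<in> Z" "j \<in> Z" for i j
  proof -
    obtain s t where "s \<in> H" "s \<in> {a + real i * l..a + real (Suc i) * l}"
        and "t \<in> H" "t \<in> {a + real j * l..a + real (Suc j) * l}"
      using ij unfolding Z_def by blast
    then have "s - a \<le> (real i + 1) * l" "real j * l \<le> t - a" "t - s \<le> l"
      using short[of s t] by (auto simp: add.commute)
    then have "real j * l \<le> (real i + 1) * l + l" by linarith
    also have "\<dots> = (real i + 2) * l" by (simp add: algebra_simps)
    finally have "real j \<le> real i + 2" using l by (simp only: mult_le_cancel_right_pos)
    then show ?thesis by linarith
  qed
  have "Z \<subseteq> {Min Z..Min Z + 2}" if "Z \<noteq> {}"
  proof -
    have "finite Z" by (simp add: Z_def)
    then show ?thesis using near[of "Min Z"] Min_in[OF _ that] Min_le[of Z] by auto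
  qed
  then have "card Z \<le> 3" using card_mono[of "{Min Z..Min Z + 2}" Z] by (cases "Z = {}") auto
  then show ?thesis by (simp add: Z_def)
qed

text \<open>
  For \<open>s = 0\<close> the hypothesis reads \<open>1 < 1\<close>.
\<close>

lemma diameter_less_of_diam_pow_less:
  assumes "diam_pow s U < ennreal (r powr s)" "U \<noteq> {}" "0 \<le> s" "0 < r"
  shows "diameter U < r"
proof (rule ccontr)
  assume "\<not> diameter U < r"
  then have "r powr s \<le> diameter U powr s" using assms by (intro powr_mono2) auto
  then show False using assms
    by (auto simp: diam_pow_def ennreal_less_iff split: if_splits)
qed

text \<open>
  Enlarging the weights by a summable positive sequence prevents sets of diameter \<open>0\<close> from having
  weight \<open>0\<close>. In the branching argument this guarantees that the limit point escapes those sets as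
  well.
\<close>

lemma positive_weights_of_null_measure:
  assumes null: "hausdorff_measure s E = 0" and c: "0 < c"
  obtains U W where "E \<subseteq> (\<Union>i. U i)" "\<And>i::nat. bounded (U i)"
    "\<And>i. diam_pow s (U i) \<le> W i" "\<And>i. 0 < W i" "(\<Sum>i. W i) < ennreal c"
proof -
  have "hausdorff_premeasure s 1 E = 0"
    using null SUP_upper[of 1 "{0<..}" "\<lambda>r. hausdorff_premeasure s r E"]
    by (simp add: hausdorff_measure_def)
  then have "(INF U\<in>delta_covers 1 E. \<Sum>i. diam_pow s (U i)) < ennreal (c/2)"
    using c by (simp add: hausdorff_premeasure_def)
  then obtain U where U: "U \<in> delta_covers 1 E" "(\<Sum>i. diam_pow s (U i)) < ennreal (c/2)"
    by (auto simp: INF_less_iff)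
  \<comment> \<open>The added weights sum to \<open>c/2\<close>.\<close>
  define W where "W i = diam_pow s (U i) + ennreal (c/2 * (1/2) ^ Suc i)" for i
  have "(\<Sum>i. ennreal (c/2 * (1/2) ^ Suc i)) = ennreal (c/2)"
    using sums_mult[OF power_half_series, of "c/2"] c by (intro suminf_ennreal_eq) auto
  then have "(\<Sum>i. W i) = (\<Sum>i. diam_pow s (U i)) + ennreal (c/2)"
    unfolding W_def by (subst suminf_add[symmetric]) auto
  also have "\<dots> < ennreal (c/2) + ennreal (c/2)"
    using U(2) by (simp add: add.commute ennreal_add_left_cancel_less)
  also have "\<dots> = ennreal c" using c by (simp flip: ennreal_plus)
  finally show ?thesis using U c
    by (intro that[of U W]) (auto simp: delta_covers_def W_def add_pos_pos intro: add_nonneg_pos)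
qed

text \<open>
  A cover of small total weight is defeated step by step. The potential \<open>\<Phi>\<close> of a piece is the total weight of
  the cover sets that meet it. If it is below \<open>l' powr s\<close>, where \<open>l'\<close> is the length of the subpieces, then all
  these cover sets are shorter than a subpiece and meet at most three of them. Hence the
  potentials of the good subpieces add up to at most three times the potential of the piece, and
  since there are at least \<open>3 * N powr s\<close> good subpieces, one of them inherits the bound at the next scale. A
  point in the intersection of the chosen pieces belongs to the set but to no cover set.
\<close>

lemma hausdorff_measure_nonzero_of_branching:
  fixes P :: "nat \<Rightarrow> real \<Rightarrow> bool" and L s a0 :: real and N K :: nat
  assumes L: "0 < L" and s: "0 \<le> s" and N: "0 < N" and many: "3 * real N powr s \<le> real N - real K"
    and start: "P 0 a0"
    and branch: "\<And>k a. P k a \<Longrightarrow>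
      card {j \<in> {..<N}. \<not> P (Suc k) (a + real j * (L / real N ^ Suc k))} \<le> K"
    and limit: "\<And>x. (\<And>k. \<exists>a. P k a \<and> x \<in> {a..a + L / real N ^ k}) \<Longrightarrow> x \<in> E"
  shows "hausdorff_measure s E \<noteq> 0"
proof
  assume null: "hausdorff_measure s E = 0"
  define l where "l k = L / real N ^ k" for k
  have l: "0 < l k" "l k = real N * l (Suc k)" for k using L N by (auto simp: l_def)
  \<comment> \<open>The threshold for the potential uses the length of the next level.\<close>
  define c where "c k = l (Suc k) powr s" for k
  have c: "0 < c k" for k using l(1)[of "Suc k"] by (simp add: c_def)
  have c_Suc: "c k = real N powr s * c (Suc k)" for k
    unfolding c_def l(2)[of "Suc k"] using l(1)[of "Suc (Suc k)"] N by (simp add: powr_mult)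
  obtain U W where U: "E \<subseteq> (\<Union>i. U i)" "\<And>i::nat. bounded (U i)"
    and W: "\<And>i. diam_pow s (U i) \<le> W i" "\<And>i. 0 < W i" "(\<Sum>i. W i) < ennreal (c 0)"
    using positive_weights_of_null_measure[OF null c[of 0]] by metis
  define J where "J k a = {a..a + l k}" for k a
  define g where "g k a i = (if U i \<inter> J k a \<noteq> {} then W i else 0)" for k a i
  define \<Phi> where "\<Phi> k a = (\<Sum>i. g k a i)" for k a
  have gW: "W i \<le> \<Phi> k a" if "U i \<inter> J k a \<noteq> {}" for i k a
  proof -
    have "W i = (\<Sum>n\<in>{i}. g k a n)" using that by (simp add: g_def)
    also have "\<dots> \<le> \<Phi> k a" unfolding \<Phi>_def by (intro sum_le_suminf) auto
    finally show ?thesis .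
  qed
  have child: "\<exists>b. (P (Suc k) b \<and> \<Phi> (Suc k) b < ennreal (c (Suc k))) \<and> J (Suc k) b \<subseteq> J k a"
    if P: "P k a" and small: "\<Phi> k a < ennreal (c k)" for k a
  proof -
    define b where "b j = a + real j * l (Suc k)" for j
    define G where "G = {j \<in> {..<N}. P (Suc k) (b j)}"
    have piece: "J (Suc k) (b j) = {a + real j * l (Suc k)..a + real (Suc j) * l (Suc k)}" for j
      by (simp add: J_def b_def algebra_simps)
    have sub: "J (Suc k) (b j) \<subseteq> J k a" if "j < N" for j
    proof -
      have "0 \<le> real j * l (Suc k)" "real (Suc j) * l (Suc k) \<le> real N * l (Suc k)"
        using l(1)[of "Suc k"] that by (auto intro!: mult_right_mono)
      then show ?thesis unfolding piece by (auto simp: J_def l(2)[of k])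
    qed
    have "{..<N} = G \<union> {j \<in> {..<N}. \<not> P (Suc k) (b j)}" by (auto simp: G_def)
    then have "N \<le> card G + card {j \<in> {..<N}. \<not> P (Suc k) (b j)}"
      by (metis card_Un_le card_lessThan)
    also have "\<dots> \<le> card G + K" using branch[OF P] by (simp add: b_def l_def)
    finally have "real N - real K \<le> real (card G)" by linarith
    then have card: "3 * real N powr s \<le> real (card G)" using many by linarith
    have "finite G" by (simp add: G_def)
    have count: "(\<Sum>j\<in>G. g (Suc k) (b j) i) \<le> 3 * g k a i" for i
    proof (cases "U i \<inter> J k a = {}")
      case True
      then have "g (Suc k) (b j) i = 0" if "j \<in> G" for j
        using sub[of j] that by (auto simp: g_def G_def)
      then show ?thesis by simp
    next
      case False
      have "diam_pow s (U i) < ennreal (c k)" using W(1)[of i] gW[OF False] small by order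
      then have "diameter (U i) < l (Suc k)"
        using False s l(1) unfolding c_def by (intro diameter_less_of_diam_pow_less) auto
      then have "\<bar>x - z\<bar> \<le> l (Suc k)" if "x \<in> U i" "z \<in> U i" for x z
        using diameter_bounded_bound[OF U(2) that] by (simp add: dist_real_def)
      then have three: "card {j \<in> {..<N}. J (Suc k) (b j) \<inter> U i \<noteq> {}} \<le> 3"
        unfolding piece by (intro card_pieces_meeting_short_set l)
      have "(\<Sum>j\<in>G. g (Suc k) (b j) i) \<le> (\<Sum>j<N. if J (Suc k) (b j) \<inter> U i \<noteq> {} then W i else 0)"
        by (auto simp: g_def G_def Int_commute intro!: sum_mono2 order_trans[OF sum_mono2])
      also have "\<dots> = of_nat (card {j \<in> {..<N}. J (Suc k) (b j) \<inter> U i \<noteq> {}}) * W i"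
        by (simp add: sum.If_cases Int_def)
      also have "\<dots> \<le> of_nat 3 * W i" using three by (intro mult_right_mono of_nat_mono) auto
      finally show ?thesis using False by (simp add: g_def)
    qed
    have "(\<Sum>j\<in>G. \<Phi> (Suc k) (b j)) = (\<Sum>i. \<Sum>j\<in>G. g (Suc k) (b j) i)"
      unfolding \<Phi>_def by (rule suminf_sum[symmetric]) simp
    also have "\<dots> \<le> (\<Sum>i. 3 * g k a i)" using count by (intro suminf_le) auto
    also have "\<dots> = 3 * \<Phi> k a" by (simp add: \<Phi>_def)
    also have "\<dots> < 3 * ennreal (c k)" using small by (simp add: ennreal_mult_strict_left_mono)
    also have "\<dots> = ennreal (3 * c k)" by (simp add: ennreal_mult')
    also have "\<dots> \<le> ennreal (real (card G) * c (Suc k))"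
      using mult_right_mono[OF card, of "c (Suc k)"] c[of "Suc k"]
      by (intro ennreal_leI) (simp add: c_Suc[of k] mult.assoc)
    also have "\<dots> = (\<Sum>j\<in>G. ennreal (c (Suc k)))"
      using c[of "Suc k"] by (simp add: ennreal_mult' ennreal_of_nat_eq_real_of_nat)
    finally have "(\<Sum>j\<in>G. \<Phi> (Suc k) (b j)) < (\<Sum>j\<in>G. ennreal (c (Suc k)))" .
    then obtain j where "j \<in> G" "\<Phi> (Suc k) (b j) < ennreal (c (Suc k))"
      by (meson not_le sum_mono)
    then show ?thesis using sub by (auto simp: G_def)
  qed
  have "\<Phi> 0 a0 \<le> (\<Sum>i. W i)" unfolding \<Phi>_def by (intro suminf_le) (auto simp: g_def)
  then have "\<exists>a. P 0 a \<and> \<Phi> 0 a < ennreal (c 0)" using start W(3) by (blast intro: le_less_trans)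
  then obtain f where f: "\<And>k. P k (f k)" "\<And>k. \<Phi> k (f k) < ennreal (c k)"
      "\<And>k. J (Suc k) (f (Suc k)) \<subseteq> J k (f k)"
    using dependent_nat_choice[of "\<lambda>k a. P k a \<and> \<Phi> k a < ennreal (c k)"
        "\<lambda>k a b. J (Suc k) b \<subseteq> J k a"] child by metis
  have "(\<Inter>k. J k (f k)) \<noteq> {}"
  proof (rule compact_nest)
    show "J n (f n) \<subseteq> J m (f m)" if "m \<le> n" for m n
      using lift_Suc_antimono_le[of "\<lambda>k. J k (f k)", OF f(3) that] .
  qed (use l(1) in \<open>auto simp: J_def less_imp_le\<close>)
  then obtain x where x: "\<And>k. x \<in> J k (f k)" by blast
  have "x \<in> E" using limit f(1) x by (auto simp: J_def l_def)
  then obtain i where i: "x \<in> U i" using U(1) by blast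
  then have Wi: "W i < ennreal (c k)" for k
    using gW[of i k "f k"] x[of k] f(2)[of k] by (meson disjoint_iff le_less_trans)
  show False
  proof (cases "s = 0")
    case True
    then have "c 0 = 1" using l(1)[of 1] by (simp add: c_def)
    moreover have "diam_pow s (U i) = 1" using True i by (auto simp: diam_pow_def)
    ultimately show False using W(1)[of i] Wi[of 0] by simp
  next
    case False
    have "1 \<le> real N powr s" using N s by (simp add: ge_one_powr_ge_zero)
    then have "1 < real N" using many by simp
    then have "1 < real N powr s" using False s by simp
    then have "(\<lambda>k. c 0 * inverse ((real N powr s) ^ k)) \<longlonglongrightarrow> c 0 * 0"
      by (intro tendsto_mult tendsto_const LIMSEQ_inverse_realpow_zero)
    moreover have "c k = c 0 * inverse ((real N powr s) ^ k)" for k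
    proof (induction k)
      case (Suc k)
      have "c (Suc k) = c k * inverse (real N powr s)"
        unfolding c_Suc[of k] using N by simp
      then show ?case using Suc by simp
    qed simp
    then have "c = (\<lambda>k. c 0 * inverse ((real N powr s) ^ k))" by (rule ext)
    ultimately have "c \<longlonglongrightarrow> 0" by (metis mult_zero_right)
    then have "(\<lambda>k. ennreal (c k)) \<longlonglongrightarrow> ennreal 0" by (rule tendsto_ennrealI)
    then have "W i \<le> ennreal 0" using Wi by (intro LIMSEQ_le_const) (auto intro: less_imp_le)
    then show False using W(2)[of i] by simp
  qed
qed

section \<open>The dimension of the intersection\<close>

lemma hausdorff_measure_unit_interval:
  assumes E: "E \<subseteq> {0..1::real}" and s: "1 < s"
  shows "hausdorff_measure s E = 0"
proof -
  have pre: "hausdorff_premeasure s \<delta> E \<le> ennreal r" if "0 < \<delta>" "0 < r" for \<delta> r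
  proof -
    have "(\<lambda>n. 1 / real n) \<longlonglongrightarrow> 0" by (rule lim_1_over_n)
    moreover have "(\<lambda>n. real n powr (1 - s)) \<longlonglongrightarrow> 0"
      using s by (intro tendsto_neg_powr filterlim_real_sequentially) auto
    ultimately have "\<forall>\<^sub>F n in sequentially. 1 / real n < \<delta> \<and> real n powr (1 - s) < r \<and> 0 < n"
      using that by (intro eventually_conj order_tendstoD(2) eventually_gt_at_top) auto
    from eventually_happens'[OF sequentially_bot this] obtain n where n: "1 / real n < \<delta>" "real n powr (1 - s) < r" "0 < n"
    by blast
    define U where "U i = (if i < n then {real i / real n..real (Suc i) / real n} else {})" for i
    have diam: "diameter (U i) = (if i < n then 1 / real n else 0)" for i
    proof -
      have "real i / real n \<le> real (Suc i) / real n" by (intro divide_right_mono) auto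
      moreover have "real (Suc i) / real n - real i / real n = 1 / real n"
        by (simp flip: diff_divide_distrib)
      ultimately show ?thesis by (simp add: U_def del: of_nat_Suc)
    qed
    have "E \<subseteq> (\<Union>i. U i)"
    proof
      fix x assume "x \<in> E"
      then have x: "0 \<le> x" "x \<le> 1" using E by auto
      show "x \<in> (\<Union>i. U i)"
      proof (cases "x = 1")
        case True
        then have "x \<in> U (n - 1)" using n(3) by (auto simp: U_def field_simps)
        then show ?thesis by blast
      next
        case False
        define i where "i = nat \<lfloor>x * real n\<rfloor>"
        have i: "real i \<le> x * real n" "x * real n < real i + 1"
          using x unfolding i_def by simp_all
        have "x * real n < 1 * real n" using x False n(3) by (intro mult_strict_right_mono) auto
        then have "real i < real n" using i(1) by linarith
        moreover have "x \<in> {real i / real n..real (Suc i) / real n}"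
          using i n(3) by (simp add: pos_divide_le_eq pos_le_divide_eq)
        ultimately have "x \<in> U i" by (simp add: U_def)
        then show ?thesis by blast
      qed
    qed
    moreover have "bounded (U i)" for i by (simp add: U_def)
    moreover have "diameter (U i) \<le> \<delta>" for i using n(1) that(1) by (simp add: diam)
    ultimately have "U \<in> delta_covers \<delta> E" by (simp add: delta_covers_def)
    then have "hausdorff_premeasure s \<delta> E \<le> (\<Sum>i. diam_pow s (U i))"
      unfolding hausdorff_premeasure_def by (rule INF_lower)
    also have "\<dots> = (\<Sum>i<n. diam_pow s (U i))"
      by (rule suminf_finite) (auto simp: U_def diam_pow_def)
    also have "\<dots> \<le> (\<Sum>i<n. ennreal ((1 / real n) powr s))"
      using s by (intro sum_mono) (auto simp: diam_pow_def diam)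
    also have "\<dots> = ennreal (real n * (1 / real n) powr s)"
      by (simp add: ennreal_mult' ennreal_of_nat_eq_real_of_nat)
    also have "real n * (1 / real n) powr s = real n powr (1 - s)"
      using n(3) by (simp add: powr_divide powr_diff)
    finally show ?thesis using n(2) by (meson ennreal_leI less_imp_le order_trans)
  qed
  have "hausdorff_premeasure s \<delta> E = 0" if "0 < \<delta>" for \<delta>
  proof -
    have "hausdorff_premeasure s \<delta> E \<le> 0"
    proof (rule ennreal_le_epsilon)
      fix r :: real assume "0 < r"
      then show "hausdorff_premeasure s \<delta> E \<le> 0 + ennreal r" using pre[OF that] by simp
    qed
    then show ?thesis by simp
  qed
  then show ?thesis unfolding hausdorff_measure_def by simp
qed

text \<open>
  All points use the same window and the same subdivision into \<open>N\<close> pieces, each with its own word;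
  the pieces lost for the individual points are simply added up.
\<close>

lemma hausdorff_measure_Inter_Lambda_nonzero:
  fixes p :: nat and y :: "nat \<Rightarrow> real"
  assumes y: "\<And>i. i \<in> {1..p} \<Longrightarrow> y i \<in> {0<..<1/2}" and s: "0 \<le> s" "s < 1"
  shows "hausdorff_measure s (\<Inter>i\<in>{1..p}. Lambda (y i)) \<noteq> 0"
proof -
  have "(\<lambda>n. real n powr (s - 1)) \<longlonglongrightarrow> 0"
    using s by (intro tendsto_neg_powr filterlim_real_sequentially) auto
  \<comment> \<open>These bounds give \<open>3 * N powr s \<le> N / 2\<close> and \<open>3 * p \<le> N / 2\<close>.\<close>
  then have "\<forall>\<^sub>F n in sequentially. real n powr (s - 1) < 1/6 \<and> 6 * p + 1 \<le> n"
    by (intro eventually_conj order_tendstoD(2) eventually_ge_at_top) auto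
  from eventually_happens'[OF sequentially_bot this] obtain N where large: "real N powr (s - 1) < 1/6" "6 * p + 1 \<le> N"
    by blast
  have "real N powr s = real N * real N powr (s - 1)" using large(2) by (simp add: powr_diff)
  also have "\<dots> \<le> real N * (1/6)" using large(1) by (intro mult_left_mono) auto
  finally have many: "3 * real N powr s \<le> real N - real (3 * p)" using large(2) by linarith
  have "\<forall>\<^sub>F q in sequentially. \<forall>i\<in>{1..p}. \<exists>w. seeded_window (y i) ((1/4) ^ q) w N"
    using y large(2) by (intro eventually_ball_finite ballI eventually_seeded_window) auto
  from eventually_happens'[OF sequentially_bot this] obtain q where "\<forall>i\<in>{1..p}. \<exists>w. seeded_window (y i) ((1/4) ^ q) w N"
    by blast
  then obtain w where w: "\<And>i. i \<in> {1..p} \<Longrightarrow> seeded_window (y i) ((1/4) ^ q) (w i) N" by metis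
  define e where "e = (1/4::real) ^ q"
  define L where "L = e / 2"
  have L: "0 < L" by (simp add: L_def e_def)
  define P where "P k a \<longleftrightarrow> (\<forall>i\<in>{1..p}. seeded_window.stage (y i) e (w i) N k a (a + L / real N ^ k))" for k a
  show ?thesis
  proof (rule hausdorff_measure_nonzero_of_branching[where P = P and L = L and N = N and K = "3 * p" and ?a0.0 = "1/2 - e"])
    show "P 0 (1/2 - e)"
      unfolding P_def using seeded_window.stage_zero[OF w] by (auto simp: L_def e_def)
    fix x assume "\<And>k. \<exists>a. P k a \<and> x \<in> {a..a + L / real N ^ k}"
    then show "x \<in> (\<Inter>i\<in>{1..p}. Lambda (y i))"
      using seeded_window.mem_Lambda_of_stages[OF w] unfolding P_def e_def by blast
  next
    fix k a assume P: "P k a"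
    define l where "l = L / real N ^ Suc k"
    have l: "0 < l" "(L / real N ^ k) / real N = l" using L large(2) by (auto simp: l_def)
    define bad where "bad i = {j \<in> {..<N}. \<not> seeded_window.stage (y i) e (w i) N (Suc k)
        (a + real j * l) (a + real j * l + l)}" for i
    have "card (bad i) \<le> 3" if i: "i \<in> {1..p}" for i
    proof -
      interpret seeded_window "y i" e "w i" N using w[OF i] by (simp add: e_def)
      have "stage k a (a + L / real N ^ k)" using P i by (simp add: P_def)
      from stage_Suc[OF this] obtain H
        where short: "\<And>s t. s \<in> H \<Longrightarrow> t \<in> H \<Longrightarrow> \<bar>s - t\<bar> \<le> l"
          and child: "\<And>a' b'. a \<le> a' \<Longrightarrow> b' \<le> a + L / real N ^ k \<Longrightarrow> b' - a' = l \<Longrightarrow>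
            {a'..b'} \<inter> H = {} \<Longrightarrow> stage (Suc k) a' b'"
        unfolding add_diff_cancel_left' l(2) by blast
      have "bad i \<subseteq> {j \<in> {..<N}. {a + real j * l..a + real (Suc j) * l} \<inter> H \<noteq> {}}"
      proof
        fix j assume j: "j \<in> bad i"
        then have "real (Suc j) * l \<le> real N * l" using l by (intro mult_right_mono) (auto simp: bad_def)
        also have "\<dots> = L / real N ^ k" using l(2) large(2) by (simp add: field_simps)
        finally have "{a + real j * l..a + real j * l + l} \<inter> H \<noteq> {}"
          using child[of "a + real j * l" "a + real j * l + l"] j l by (auto simp: bad_def algebra_simps)
        then show "j \<in> {j \<in> {..<N}. {a + real j * l..a + real (Suc j) * l} \<inter> H \<noteq> {}}"
          using j by (auto simp: bad_def algebra_simps)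
      qed
      then have "card (bad i) \<le> card {j \<in> {..<N}. {a + real j * l..a + real (Suc j) * l} \<inter> H \<noteq> {}}"
        by (intro card_mono) auto
      also have "\<dots> \<le> 3" using short l by (intro card_pieces_meeting_short_set)
      finally show ?thesis .
    qed
    then have "(\<Sum>i\<in>{1..p}. card (bad i)) \<le> (\<Sum>i\<in>{1..p}. 3)" by (intro sum_mono)
    moreover have "{j \<in> {..<N}. \<not> P (Suc k) (a + real j * l)} = (\<Union>i\<in>{1..p}. bad i)"
      by (auto simp: P_def bad_def l_def)
    ultimately show "card {j \<in> {..<N}. \<not> P (Suc k) (a + real j * (L / real N ^ Suc k))} \<le> 3 * p"
      using card_UN_le[of "{1..p}" bad] unfolding l_def[symmetric] by simp
  qed (use L s large many in auto)
qed

theorem theorem1p4: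
  fixes p :: nat and y :: "nat \<Rightarrow> real"
  assumes "p \<ge> 1"
    and "\<And>i. i \<in> {1..p} \<Longrightarrow> y i \<in> {0<..<1/2}"
  shows "hausdorff_dim (\<Inter>i\<in>{1..p}. Lambda (y i)) = 1"
proof (rule antisym)
  let ?E = "\<Inter>i\<in>{1..p}. Lambda (y i)"
  have "?E \<subseteq> Lambda (y 1)" using assms(1) by auto
  then have "?E \<subseteq> {0..1}" by (force simp: Lambda_def)
  then have null: "hausdorff_measure s ?E = 0" if "1 < s" for s
    using that by (rule hausdorff_measure_unit_interval)
  show "hausdorff_dim ?E \<le> 1"
  proof (rule ennreal_le_epsilon)
    fix r :: real assume "0 < r"
    then have "hausdorff_dim ?E \<le> ennreal (1 + r)"
      unfolding hausdorff_dim_def using null[of "1 + r"]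
      by (intro Inf_lower CollectI exI[of _ "1 + r"]) auto
    then show "hausdorff_dim ?E \<le> 1 + ennreal r" using \<open>0 < r\<close> by simp
  qed
  show "1 \<le> hausdorff_dim ?E"
    unfolding hausdorff_dim_def
  proof (rule Inf_greatest, clarify)
    fix s :: real assume "0 \<le> s" "hausdorff_measure s ?E = 0"
    then have "1 \<le> s" using hausdorff_measure_Inter_Lambda_nonzero[OF assms(2), where s = s] by force
    then show "1 \<le> ennreal s" by simp
  qed
qed

end
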